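(* Let $q=2^e$ where $e$ is odd and $e>1$, and let $Sz(q)$ be the Suzuki group over $\mathbb F_q$. Let $H$ be a maximal subgroup of $Sz(q)$ that is dihedral of order $2(q-1)$, and let $\Omega$ be the set of right cosets of $H$, on which $Sz(q)$ acts by right multiplication. Then $RC(Sz(q),\Omega)=3$.
   Context: Groups act on the right. Let a finite group $G$ act non-trivially on a finite set $\Omega$; $G$ acts entrywise on $\Omega^m$. For $1\le k\le m$ and $I,J\in\Omega^m$, write $I\sim_k J$ if for all $1\le p_1<\dots<p_k\le m$ there is $g\in G$ with $I_{p_i}^g=J_{p_i}$ for all $i\in\{1,\dots,k\}$. The relational complexity $RC(G,\Omega)$ is the least integer $k\ge 2$ such that for all integers $m\ge k$ and all $I,J\in\Omega^m$, $I\sim_k J$ implies $I\sim_m J$. *)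

theory Defs
  imports "HOL-Algebra.Generated_Groups" "HOL-Analysis.Cartesian_Space"
begin

section \<open>Relational complexity\<close>

text \<open>
  Groups act on the right: \<open>act x g\<close> stands for \<open>x\<^sup>g\<close>. A tuple in \<open>\<Omega>\<^sup>m\<close> is an extensional
  function on \<open>{1..m}\<close>.
\<close>

definition tuple_equiv ::
  "('g, 'b) monoid_scheme \<Rightarrow> ('x \<Rightarrow> 'g \<Rightarrow> 'x) \<Rightarrow> nat \<Rightarrow> nat \<Rightarrow> (nat \<Rightarrow> 'x) \<Rightarrow> (nat \<Rightarrow> 'x) \<Rightarrow> bool"
  where
  "tuple_equiv G act m k I J \<longleftrightarrow>
     (\<forall>p. p \<in> {1..k} \<rightarrow> {1..m} \<and> strict_mono_on {1..k} p \<longrightarrow>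
        (\<exists>g\<in>carrier G. \<forall>i\<in>{1..k}. act (I (p i)) g = J (p i)))"

definition relational_complexity ::
  "('g, 'b) monoid_scheme \<Rightarrow> 'x set \<Rightarrow> ('x \<Rightarrow> 'g \<Rightarrow> 'x) \<Rightarrow> nat"
  where
  "relational_complexity G \<Omega> act =
     (LEAST k. 2 \<le> k \<and>
        (\<forall>m\<ge>k. \<forall>I \<in> {1..m} \<rightarrow>\<^sub>E \<Omega>. \<forall>J \<in> {1..m} \<rightarrow>\<^sub>E \<Omega>.
           tuple_equiv G act m k I J \<longrightarrow> tuple_equiv G act m m I J))"

text \<open>For finite \<open>\<Omega>\<close> the minimum is over a nonempty set, so it is not a junk value.\<close>

lemma relational_complexity_exists:
  fixes \<Omega> :: "'x set"
  assumes fin: "finite \<Omega>"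
  shows "\<exists>k\<ge>2. \<forall>m\<ge>k. \<forall>I \<in> {1..m} \<rightarrow>\<^sub>E \<Omega>. \<forall>J \<in> {1..m} \<rightarrow>\<^sub>E \<Omega>.
           tuple_equiv G act m k I J \<longrightarrow> tuple_equiv G act m m I J"
proof (intro exI conjI allI impI ballI)
  define k where "k = card (\<Omega> \<times> \<Omega>) + 2"
  show "2 \<le> k" by (simp add: k_def)
  fix m I J
  assume mk: "k \<le> m" and I: "I \<in> {1..m} \<rightarrow>\<^sub>E \<Omega>" and J: "J \<in> {1..m} \<rightarrow>\<^sub>E \<Omega>"
    and eq: "tuple_equiv G act m k I J"
  let ?f = "\<lambda>i. (I i, J i)"
  have sub: "?f ` {1..m} \<subseteq> \<Omega> \<times> \<Omega>" using I J by auto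
  obtain Q where Q: "Q \<subseteq> {1..m}" "inj_on ?f Q" "?f ` {1..m} = ?f ` Q"
    using subset_image_inj[of "?f ` {1..m}" ?f "{1..m}"] by auto
  have "card Q = card (?f ` Q)" using Q(2) by (simp add: card_image)
  also have "\<dots> \<le> card (\<Omega> \<times> \<Omega>)"
    using sub Q(3) fin by (metis card_mono finite_SigmaI)
  finally have "card Q \<le> k" by (simp add: k_def)
  then obtain P where P: "Q \<subseteq> P" "P \<subseteq> {1..m}" "card P = k"
    using exists_subset_between[of Q k "{1..m}"] Q(1) mk by auto
  have finP: "finite P" using P(2) finite_subset by blast
  define ps where "ps = sorted_list_of_set P"
  have ps: "set ps = P" "length ps = k" "sorted_wrt (<) ps"
    using finP P(3) by (auto simp: ps_def)
  define p where "p i = ps ! (i - 1)" for i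
  have img: "p ` {1..k} = P"
  proof -
    have "p ` {1..k} = (!) ps ` ((\<lambda>i. i - 1) ` {1..k})"
      by (simp add: p_def image_image)
    also have "(\<lambda>i. i - 1) ` {1..k} = {..<k}"
    proof (intro Set.set_eqI iffI)
      fix x assume "x \<in> {..<k}"
      then show "x \<in> (\<lambda>i. i - 1) ` {1..k}" by (intro image_eqI[of _ _ "Suc x"]) auto
    qed auto
    also have "(!) ps ` {..<k} = P" using ps by (auto simp: set_conv_nth image_iff)
    finally show ?thesis .
  qed
  have "strict_mono_on {1..k} p"
    using ps by (intro strict_mono_onI) (auto simp: p_def sorted_wrt_iff_nth_less)
  then obtain g where g: "g \<in> carrier G" "\<forall>i\<in>{1..k}. act (I (p i)) g = J (p i)"
    using eq img P(2) unfolding tuple_equiv_def by blast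
  have "act (I i) g = J i" if i: "i \<in> {1..m}" for i
  proof -
    obtain j where j: "j \<in> Q" "?f i = ?f j" using i Q(3) by (metis (no_types, lifting) imageE imageI)
    then obtain l where "l \<in> {1..k}" "p l = j" using P(1) img by blast
    with g j show ?thesis by auto
  qed
  with g(1) show "tuple_equiv G act m m I J"
    unfolding tuple_equiv_def by blast
qed


section \<open>Maximal subgroups and dihedral groups\<close>

definition maximal_subgroup :: "'g set \<Rightarrow> ('g, 'b) monoid_scheme \<Rightarrow> bool" where
  "maximal_subgroup H G \<longleftrightarrow>
     subgroup H G \<and> H \<noteq> carrier G \<and>
     (\<forall>K. subgroup K G \<and> H \<subseteq> K \<longrightarrow> K = H \<or> K = carrier G)"

text \<open>
  The dihedral group of order \<open>2n\<close> as the semidirect product of \<open>\<int>/n\<close> by a group of order \<open>2\<close>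
  acting by inversion; \<open>(i, s)\<close> stands for \<open>\<rho>\<^sup>i\<sigma>\<^sup>s\<close> with \<open>\<rho>\<close> a rotation of order \<open>n\<close> and \<open>\<sigma>\<close> a
  reflection.
\<close>

definition dihedral_group :: "nat \<Rightarrow> (int \<times> bool) monoid" where
  "dihedral_group n =
     \<lparr>carrier = {0..<int n} \<times> UNIV,
      mult = (\<lambda>(i, s) (j, t). ((if s then i - j else i + j) mod int n, s \<noteq> t)),
      one = (0, False)\<rparr>"

lemma group_dihedral_group:
  assumes "n > 0"
  shows "group (dihedral_group n)"
proof (rule groupI)
  fix x y z
  assume "x \<in> carrier (dihedral_group n)" "y \<in> carrier (dihedral_group n)"
    "z \<in> carrier (dihedral_group n)"
  show "x \<otimes>\<^bsub>dihedral_group n\<^esub> y \<otimes>\<^bsub>dihedral_group n\<^esub> z =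
        x \<otimes>\<^bsub>dihedral_group n\<^esub> (y \<otimes>\<^bsub>dihedral_group n\<^esub> z)"
    by (cases x; cases y; cases z)
      (auto simp: dihedral_group_def mod_simps algebra_simps)
next
  fix x assume x: "x \<in> carrier (dihedral_group n)"
  obtain i s where [simp]: "x = (i, s)" by (cases x)
  have "((if s then i else - i) mod int n, s) \<in> carrier (dihedral_group n)"
    "((if s then i else - i) mod int n, s) \<otimes>\<^bsub>dihedral_group n\<^esub> x = \<one>\<^bsub>dihedral_group n\<^esub>"
    using assms by (auto simp: dihedral_group_def mod_simps)
  then show "\<exists>y\<in>carrier (dihedral_group n). y \<otimes>\<^bsub>dihedral_group n\<^esub> x = \<one>\<^bsub>dihedral_group n\<^esub>"
    by blast
qed (use assms in \<open>auto simp: dihedral_group_def\<close>)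

lemma order_dihedral_group: "order (dihedral_group n) = 2 * n"
  by (simp add: order_def dihedral_group_def card_cartesian_product)


section \<open>Suzuki groups\<close>

definition general_linear_group :: "('a::field^'n^'n) monoid" where
  "general_linear_group = \<lparr>carrier = {A. invertible A}, mult = (**), one = mat 1\<rparr>"

lemma group_general_linear_group: "group (general_linear_group :: ('a::field^'n^'n) monoid)"
proof (rule groupI)
  fix x :: "'a^'n^'n"
  assume "x \<in> carrier general_linear_group"
  then obtain y where "x ** y = mat 1" "y ** x = mat 1"
    by (auto simp: general_linear_group_def invertible_def)
  then show "\<exists>y\<in>carrier general_linear_group.
      y \<otimes>\<^bsub>general_linear_group\<^esub> x = \<one>\<^bsub>general_linear_group\<^esub>"
    by (intro bexI[of _ y]) (auto simp: general_linear_group_def invertible_def)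
qed (auto simp: general_linear_group_def invertible_mult matrix_mul_assoc[symmetric],
     auto simp: invertible_def intro!: exI[of _ "mat 1"])

lemma vector_4_nth:
  "(vector [a, b, c, d] :: 'a::zero^4) $ 1 = a"
  "(vector [a, b, c, d] :: 'a::zero^4) $ 2 = b"
  "(vector [a, b, c, d] :: 'a::zero^4) $ 3 = c"
  "(vector [a, b, c, d] :: 'a::zero^4) $ 4 = d"
  by (simp_all add: vector_def)

text \<open>
  Suzuki's description of \<open>Sz(q)\<close>, \<open>q = 2\<^sup>e\<close> with \<open>e = 2r + 1\<close>, as a subgroup of the general linear
  group of degree 4 over the field \<open>'a\<close> with \<open>q\<close> elements. Here \<open>e div 2 = r\<close>, and
  \<open>\<theta> : x \<mapsto> x\<^bsup>2^(r+1)\<^esup>\<close> is the field automorphism whose square is \<open>x \<mapsto> x\<^sup>2\<close>.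
\<close>

definition suzuki_theta :: "nat \<Rightarrow> 'a::field \<Rightarrow> 'a" where
  "suzuki_theta e x = x ^ (2 ^ (e div 2 + 1))"

definition suzuki_S :: "nat \<Rightarrow> 'a::field \<Rightarrow> 'a \<Rightarrow> 'a^4^4" where
  "suzuki_S e a b = vector
     [vector [1, 0, 0, 0],
      vector [a, 1, 0, 0],
      vector [b, suzuki_theta e a, 1, 0],
      vector [a ^ 2 * suzuki_theta e a + a * b + suzuki_theta e b, a * suzuki_theta e a + b, a, 1]]"

definition suzuki_M :: "nat \<Rightarrow> 'a::field \<Rightarrow> 'a^4^4" where
  "suzuki_M e c = vector
     [vector [c ^ (1 + 2 ^ (e div 2)), 0, 0, 0],
      vector [0, c ^ (2 ^ (e div 2)), 0, 0],
      vector [0, 0, inverse (c ^ (2 ^ (e div 2))), 0],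
      vector [0, 0, 0, inverse (c ^ (1 + 2 ^ (e div 2)))]]"

definition suzuki_T :: "'a::field^4^4" where
  "suzuki_T = vector
     [vector [0, 0, 0, 1],
      vector [0, 0, 1, 0],
      vector [0, 1, 0, 0],
      vector [1, 0, 0, 0]]"

definition suzuki_generators :: "nat \<Rightarrow> ('a::field^4^4) set" where
  "suzuki_generators e =
     {suzuki_S e a b | a b. True} \<union> {suzuki_M e c | c. c \<noteq> 0} \<union> {suzuki_T}"

lemma suzuki_generators_subset: "suzuki_generators e \<subseteq> carrier general_linear_group"
proof -
  note mat4 = vec_eq_iff forall_4 matrix_matrix_mult_def mat_def sum_4 vector_4_nth
  have "invertible (suzuki_S e a b)" for a b :: 'a
  proof -
    have "\<exists>B. (vector [vector [1, 0, 0, 0], vector [a, 1, 0, 0], vector [b, t, 1, 0], vector [u, v, a, 1]] :: 'a^4^4) ** B = mat 1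
        \<and> B ** (vector [vector [1, 0, 0, 0], vector [a, 1, 0, 0], vector [b, t, 1, 0], vector [u, v, a, 1]] :: 'a^4^4) = mat 1"
      for t u v
      by (rule exI[of _ "vector [vector [1, 0, 0, 0], vector [- a, 1, 0, 0],
            vector [t * a - b, - t, 1, 0],
            vector [v * a + a * b - a * t * a - u, a * t - v, - a, 1]]"])
        (simp add: mat4 algebra_simps)
    then show ?thesis by (simp add: suzuki_S_def invertible_def)
  qed
  moreover have "invertible (suzuki_M e c)" if "c \<noteq> 0" for c :: 'a
    unfolding invertible_def suzuki_M_def using that
    by (intro exI[of _ "suzuki_M e (inverse c)"])
      (simp add: suzuki_M_def mat4 power_inverse field_simps)
  moreover have "invertible (suzuki_T :: 'a^4^4)"
    unfolding invertible_def suzuki_T_def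
    by (intro exI[of _ suzuki_T]) (simp add: suzuki_T_def mat4)
  ultimately show ?thesis by (auto simp: suzuki_generators_def general_linear_group_def)
qed

definition suzuki_group :: "nat \<Rightarrow> ('a::field^4^4) monoid" where
  "suzuki_group e = subgroup_generated general_linear_group (suzuki_generators e)"

lemma group_suzuki_group: "group (suzuki_group e :: ('a::field^4^4) monoid)"
  unfolding suzuki_group_def
  by (rule group.group_subgroup_generated[OF group_general_linear_group])

end

theory Submission
  imports Defs "HOL-Number_Theory.Cong"
begin

text \<open>
  \<open>Sz(q)\<close> acts 2-transitively on the Suzuki--Tits ovoid of \<open>q\<^sup>2 + 1\<close> points in \<open>PG(3, q)\<close>, only the
  identity fixes three points, and no involution fixes two. It follows that \<open>H\<close> is the stabiliser of a
  pair of points, and \<open>\<Omega>\<close> may be identified with the set of all pairs.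

  Upper bound: let \<open>I\<close> and \<open>J\<close> be 3-equivalent and, without loss of generality, agree at \<open>a\<close> and \<open>b\<close>,
  with \<open>I\<^sub>a \<noteq> I\<^sub>b\<close>. Suppose that \<open>I\<^sub>c \<noteq> J\<^sub>c\<close>; then \<open>J\<^sub>c\<close> is the image of \<open>I\<^sub>c\<close> under the unique
  non-identity element \<open>t\<close> fixing \<open>I\<^sub>a\<close> and \<open>I\<^sub>b\<close>. If \<open>t\<close> did not map \<open>I\<^sub>d\<close> to \<open>J\<^sub>d\<close>, then \<open>J\<^sub>d = I\<^sub>d\<close>
  and some \<open>u\<close> fixes \<open>I\<^sub>a\<close> and \<open>I\<^sub>d\<close> and maps \<open>I\<^sub>c\<close> to \<open>J\<^sub>c\<close>. Both \<open>t\<close> and \<open>u\<close> swap the two points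
  of \<open>I\<^sub>a\<close>, so their quotient fixes these points and stabilises \<open>I\<^sub>c\<close>. This forces \<open>t = u\<close>, a
  contradiction.

  Lower bound: the torus fixing \<open>\<infinity>\<close> and a point of the form \<open>(0, y)\<close> is transitive on the other points
  of this form. So for \<open>w \<noteq> 0, 1\<close> the triples of pairs of \<open>\<infinity>\<close> with \<open>(0, 0)\<close>, \<open>(0, 1)\<close>, \<open>(0, w)\<close> and of
  \<open>\<infinity>\<close> with \<open>(0, 0)\<close>, \<open>(0, 1)\<close>, \<open>(0, w + 1)\<close> are 2-equivalent, but not 3-equivalent.
\<close>

section \<open>Fixed points of permutations of prime order\<close>

lemma funpow_fixed:
  assumes "(f ^^ m) x = x"
  shows "(f ^^ (m * k)) x = x"
  using assms by (induction k) (simp_all add: funpow_add)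

text \<open>Every point that is not fixed lies in an orbit of exactly \<open>p\<close> elements; the
  induction removes one such orbit at a time.\<close>

lemma card_fixed_points_cong:
  assumes "finite A" and p: "prime (p::nat)" and "f ` A \<subseteq> A"
    and "\<And>x. x \<in> A \<Longrightarrow> (f ^^ p) x = x"
  shows "[card {x\<in>A. f x = x} = card A] (mod p)"
  using assms(1,3,4)
proof (induction A rule: finite_psubset_induct)
  case (psubset A)
  show ?case
  proof (cases "\<forall>x\<in>A. f x = x")
    case True
    then have "{x\<in>A. f x = x} = A" by auto
    then show ?thesis by simp
  next
    case False
    then obtain x where x: "x \<in> A" "f x \<noteq> x" by blast
    define B where "B = (\<lambda>k. (f ^^ k) x) ` {..<p}"
    have p0: "p > 0" using p prime_gt_0_nat by blast
    have px: "(f ^^ p) x = x" using psubset.prems(2) x(1) .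
    have inA: "(f ^^ k) x \<in> A" for k
      using x(1) psubset.prems(1) by (induction k) auto
    have round: "(f ^^ (p - k)) ((f ^^ k) x) = x" if "k < p" for k
      using that px by (metis comp_apply funpow_add le_add_diff_inverse2 less_imp_le)
    have no_fix: "(f ^^ d) x \<noteq> x" if "0 < d" "d < p" for d
    proof
      assume d: "(f ^^ d) x = x"
      have "coprime d p"
        using that p by (metis coprime_commute nat_dvd_not_less prime_imp_coprime)
      \<comment> \<open>Bezout for the coprime exponents \<open>d\<close> and \<open>p\<close>: the
        iterate \<open>f ^^ (d * a)\<close> fixes \<open>x\<close>, but it equals
        \<open>f ^^ (p * b + 1)\<close>, which acts on \<open>x\<close> as \<open>f\<close>
        does.\<close>
      then obtain a b where ab: "d * a = p * b + 1"
        using coprime_bezout_strong[of d p] p by (metis not_prime_1)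
      have "f x = (f ^^ (1 + p * b)) x"
        using funpow_fixed[OF px, of b] by simp
      also have "\<dots> = x" using funpow_fixed[OF d, of a] ab by simp
      finally show False using x(2) by simp
    qed
    have "inj_on (\<lambda>k. (f ^^ k) x) {..<p}"
    proof (rule linorder_inj_onI)
      fix i j assume ij: "i < j" "i \<in> {..<p}" "j \<in> {..<p}"
      show "(f ^^ i) x \<noteq> (f ^^ j) x"
      proof
        assume eq: "(f ^^ i) x = (f ^^ j) x"
        \<comment> \<open>The coincidence says that \<open>f ^^ (j - i)\<close> fixes
          \<open>(f ^^ i) x\<close>. The commuting iterate \<open>f ^^ (p - i)\<close> carries this
          back to \<open>x\<close>, against \<open>no_fix\<close>.\<close>
        have "(f ^^ (j - i)) x = (f ^^ (j - i)) ((f ^^ (p - i)) ((f ^^ i) x))"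
          using round ij by simp
        also have "\<dots> = (f ^^ (p - i)) ((f ^^ (j - i)) ((f ^^ i) x))"
          by (metis add.commute comp_apply funpow_add)
        also have "(f ^^ (j - i)) ((f ^^ i) x) = (f ^^ i) x"
          using eq ij by (metis comp_apply funpow_add le_add_diff_inverse2 less_imp_le)
        also have "(f ^^ (p - i)) ((f ^^ i) x) = x" using round ij by simp
        finally show False using no_fix[of "j - i"] ij by (simp add: less_imp_diff_less)
      qed
    qed auto
    then have cardB: "card B = p" by (simp add: B_def card_image)
    have BA: "B \<subseteq> A" using inA by (auto simp: B_def)
    have fB: "f y \<in> B" if "y \<in> B" for y
    proof -
      obtain k where k: "k < p" "y = (f ^^ k) x" using \<open>y \<in> B\<close> by (auto simp: B_def)
      show ?thesis
      proof (cases "Suc k = p")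
        case True
        then have "f y = (f ^^ 0) x" using k px by auto
        then show ?thesis using p0 unfolding B_def by blast
      next
        case False
        then show ?thesis using k unfolding B_def by (intro image_eqI[of _ _ "Suc k"]) auto
      qed
    qed
    have fkB: "(f ^^ k) y \<in> B" if "y \<in> B" for y k
      using that by (induction k) (auto intro: fB)
    have not_fixed: "f y \<noteq> y" if "y \<in> B" for y
    proof
      assume "f y = y"
      then have *: "(f ^^ k) y = y" for k by (induction k) auto
      obtain k where k: "k < p" "y = (f ^^ k) x" using \<open>y \<in> B\<close> by (auto simp: B_def)
      then have "y = x" using round[OF k(1)] * by simp
      then show False using \<open>f y = y\<close> x(2) by simp
    qed
    have "f y \<in> A - B" if "y \<in> A - B" for y
    proof -
      \<comment> \<open>As \<open>f ^^ (p - 1)\<close> undoes \<open>f\<close> on \<open>A\<close>,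
        having \<open>f y\<close> in the orbit \<open>B\<close> would put \<open>y\<close> into
        \<open>B\<close>.\<close>
      have "(f ^^ (p - 1)) (f y) = y"
        using psubset.prems(2)[of y] that p0
        by (metis DiffD1 Suc_pred' comp_apply funpow_Suc_right)
      then show ?thesis using fkB[of "f y" "p - 1"] that psubset.prems(1) by auto
    qed
    then have "[card {y\<in>A - B. f y = y} = card (A - B)] (mod p)"
      using psubset.prems(2) BA x p0
      by (intro psubset.IH) (auto simp: B_def)
    moreover have "{y\<in>A - B. f y = y} = {y\<in>A. f y = y}" using not_fixed by auto
    moreover have "card A = card (A - B) + p"
      using cardB BA psubset.hyps card_Diff_subset[of B A] card_mono[of A B]
      by (simp add: finite_subset)
    ultimately show ?thesis by (simp add: cong_def)
  qed
qed


section \<open>Relational complexity of rigid actions\<close>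

text \<open>Replaces increasing sequences of exactly \<open>k\<close> positions by sets of at most
  \<open>k\<close>. A smaller set can be padded to size \<open>k\<close> because
  \<open>k \<le> m\<close>.\<close>

lemma tuple_equiv_iff:
  assumes "k \<le> m"
  shows "tuple_equiv G act m k I J \<longleftrightarrow>
    (\<forall>P\<subseteq>{1..m}. card P \<le> k \<longrightarrow> (\<exists>g\<in>carrier G. \<forall>i\<in>P. act (I i) g = J i))"
    (is "?lhs \<longleftrightarrow> ?rhs")
proof
  assume eq: ?lhs
  show ?rhs
  proof (intro allI impI)
    fix P assume P: "P \<subseteq> {1..m}" "card P \<le> k"
    then obtain R where R: "P \<subseteq> R" "R \<subseteq> {1..m}" "card R = k"
      using exists_subset_between[of P k "{1..m}"] assms by auto
    have "finite R" using R(2) finite_subset by blast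
    then obtain h where h: "bij_betw h {..<card R} R" "strict_mono_on {..<card R} h"
      using ex_bij_betw_strict_mono_card by blast
    \<comment> \<open>The enumeration \<open>h\<close> starts at 0, positions start at 1.\<close>
    define p where "p i = h (i - 1)" for i
    have "p \<in> {1..k} \<rightarrow> {1..m}"
    proof
      fix i assume "i \<in> {1..k}"
      then have "i - 1 \<in> {..<card R}" using R(3) by auto
      then show "p i \<in> {1..m}" using h(1) R(2) unfolding p_def bij_betw_def by blast
    qed
    moreover have "strict_mono_on {1..k} p"
      using R(3) unfolding p_def by (intro strict_mono_onI strict_mono_onD[OF h(2)]) auto
    ultimately obtain g where g: "g \<in> carrier G" "\<forall>i\<in>{1..k}. act (I (p i)) g = J (p i)"
      using eq unfolding tuple_equiv_def by blast
    have "act (I i) g = J i" if "i \<in> P" for i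
    proof -
      have "i \<in> h ` {..<k}" using that R h(1) by (auto simp: bij_betw_imp_surj_on)
      then obtain j where "j \<in> {..<k}" "h j = i" by blast
      then have "Suc j \<in> {1..k}" "p (Suc j) = i" by (auto simp: p_def)
      then show ?thesis using g(2) by blast
    qed
    with g(1) show "\<exists>g\<in>carrier G. \<forall>i\<in>P. act (I i) g = J i" by blast
  qed
next
  assume r: ?rhs
  show ?lhs
    unfolding tuple_equiv_def
  proof (intro allI impI, elim conjE)
    fix p :: "nat \<Rightarrow> nat" assume "p \<in> {1..k} \<rightarrow> {1..m}"
    moreover have "card (p ` {1..k}) \<le> k"
      using card_image_le[of "{1..k}" p] by simp
    ultimately show "\<exists>g\<in>carrier G. \<forall>i\<in>{1..k}. act (I (p i)) g = J (p i)"
      using r[rule_format, of "p ` {1..k}"] by auto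
  qed
qed

text \<open>
  The axiom \<open>rigid\<close> abstracts the following feature of dihedral stabilisers: a non-identity element of
  \<open>G\<^sub>x\<close> fixing a further point is a reflection, so the quotient of two such elements is a rotation,
  and rotations fix no further point.
\<close>

locale rigid_action = group G for G (structure) +
  fixes \<Omega> :: "'x set" and act :: "'x \<Rightarrow> 'a \<Rightarrow> 'x"
  assumes act_in: "x \<in> \<Omega> \<Longrightarrow> g \<in> carrier G \<Longrightarrow> act x g \<in> \<Omega>"
    and act_1: "x \<in> \<Omega> \<Longrightarrow> act x \<one> = x"
    and act_act: "x \<in> \<Omega> \<Longrightarrow> g \<in> carrier G \<Longrightarrow> h \<in> carrier G \<Longrightarrow> act (act x g) h = act x (g \<otimes> h)"
    and rigid: "\<lbrakk>x \<in> \<Omega>; g \<in> carrier G; h \<in> carrier G; g \<noteq> \<one>; h \<noteq> \<one>; act x g = x; act x h = x;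
       y \<in> \<Omega>; y \<noteq> x; act y g = y; y' \<in> \<Omega>; y' \<noteq> x; act y' h = y';
       z \<in> \<Omega>; z \<noteq> x; act z g = act z h\<rbrakk> \<Longrightarrow> g = h"
begin

lemma act_inv:
  assumes "x \<in> \<Omega>" "g \<in> carrier G"
  shows "act (act x (inv g)) g = x" "act (act x g) (inv g) = x"
  using assms by (simp_all add: act_act act_1)

text \<open>The upper bound: an element matching two distinct entries and one moved entry is shown
  to match all entries.\<close>

lemma tuple_equiv_3_imp:
  assumes m: "3 \<le> m" and I: "\<And>i. i \<in> {1..m} \<Longrightarrow> I i \<in> \<Omega>" and J: "\<And>i. i \<in> {1..m} \<Longrightarrow> J i \<in> \<Omega>"
    and eq: "tuple_equiv G act m 3 I J"
  shows "tuple_equiv G act m m I J"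
proof -
  have triple: "\<exists>g\<in>carrier G. act (I i) g = J i \<and> act (I j) g = J j \<and> act (I k) g = J k"
    if "i \<in> {1..m}" "j \<in> {1..m}" "k \<in> {1..m}" for i j k
  proof -
    have "card {i, j, k} \<le> 3" by (simp add: card_insert_if)
    then show ?thesis
      using eq[unfolded tuple_equiv_iff[OF m], rule_format, of "{i, j, k}"] that by auto
  qed
  have "\<exists>g\<in>carrier G. \<forall>i\<in>{1..m}. act (I i) g = J i"
  proof (cases "\<exists>a\<in>{1..m}. \<exists>b\<in>{1..m}. I a \<noteq> I b")
    case False
    have one: "1 \<in> {1..m}" using m by simp
    obtain g where g: "g \<in> carrier G" "act (I 1) g = J 1" using triple[OF one one one] by blast
    have "act (I i) g = J i" if i: "i \<in> {1..m}" for i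
    proof -
      have "I i = I 1" using False i one by blast
      with triple[OF i one one] g show ?thesis by auto
    qed
    with g show ?thesis by blast
  next
    case True
    then obtain a b where a: "a \<in> {1..m}" and b: "b \<in> {1..m}" and ab: "I a \<noteq> I b" by blast
    obtain g0 where g0: "g0 \<in> carrier G" "act (I a) g0 = J a" "act (I b) g0 = J b"
      using triple[OF a b b] by blast
    \<comment> \<open>Pulling \<open>J\<close> back along \<open>g0\<close> gives a tuple that
      agrees with \<open>I\<close> at \<open>a\<close> and \<open>b\<close>; the element found for
      it is multiplied by \<open>g0\<close> at the end.\<close>
    define K where "K i = act (J i) (inv g0)" for i
    have K: "K a = I a" "K b = I b"
      using g0 I a b by (auto simp: K_def act_inv simp flip: g0(2,3))
    have tripleK: "\<exists>g\<in>carrier G. act (I i) g = K i \<and> act (I j) g = K j \<and> act (I k) g = K k"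
      if ijk: "i \<in> {1..m}" "j \<in> {1..m}" "k \<in> {1..m}" for i j k
    proof -
      obtain g where g: "g \<in> carrier G" "act (I i) g = J i" "act (I j) g = J j" "act (I k) g = J k"
        using triple[OF ijk] by blast
      then show ?thesis
        using g0 I ijk by (intro bexI[of _ "g \<otimes> inv g0"]) (simp_all add: K_def flip: act_act)
    qed
    have "\<exists>g\<in>carrier G. \<forall>i\<in>{1..m}. act (I i) g = K i"
    proof (cases "\<forall>i\<in>{1..m}. K i = I i")
      case True
      then show ?thesis using I by (intro bexI[of _ \<one>]) (auto simp: act_1)
    next
      case False
      then obtain c where c: "c \<in> {1..m}" "K c \<noteq> I c" by blast
      obtain t where t: "t \<in> carrier G" "act (I a) t = I a" "act (I b) t = I b" "act (I c) t = K c"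
        using tripleK[OF a b c(1)] K by auto
      have t1: "t \<noteq> \<one>" using t(4) c I act_1 by metis
      have "act (I d) t = K d" if d: "d \<in> {1..m}" for d
      proof (rule ccontr)
        assume neq: "act (I d) t \<noteq> K d"
        obtain s where s: "s \<in> carrier G" "act (I a) s = I a" "act (I b) s = I b" "act (I d) s = K d"
          using tripleK[OF a b d] K by auto
        \<comment> \<open>Otherwise rigidity at \<open>I a\<close>, with \<open>I b\<close> as all
          three further points, gives \<open>s = t\<close>, although only \<open>s\<close> maps
          \<open>I d\<close> to \<open>K d\<close>.\<close>
        have "s = \<one>"
        proof (rule ccontr)
          assume "s \<noteq> \<one>"
          then have "s = t"
            using rigid[of "I a" s t "I b" "I b" "I b"] s t t1 I a b ab by auto
          with s neq show False by simp
        qed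
        then have Kd: "K d = I d" using s(4) I d act_1 by auto
        obtain u where u: "u \<in> carrier G" "act (I a) u = I a" "act (I c) u = K c" "act (I d) u = I d"
          using tripleK[OF a c(1) d] K Kd by auto
        have u1: "u \<noteq> \<one>" using u(3) c I act_1 by metis
        have "I d \<noteq> I a" using neq Kd t(2) by auto
        moreover have "I c \<noteq> I a" using c t(2,4) by auto
        \<comment> \<open>Rigidity at \<open>I a\<close>: \<open>t\<close> also fixes
          \<open>I b\<close>, \<open>u\<close> also fixes \<open>I d\<close>, and both map
          \<open>I c\<close> to \<open>K c\<close>.\<close>
        ultimately have "t = u"
          using rigid[of "I a" t u "I b" "I d" "I c"] t u t1 u1 I a b c d ab by auto
        then show False using neq Kd u(4) by simp
      qed
      with t(1) show ?thesis by blast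
    qed
    then obtain g where g: "g \<in> carrier G" "\<forall>i\<in>{1..m}. act (I i) g = K i" by blast
    have "act (I i) (g \<otimes> g0) = J i" if "i \<in> {1..m}" for i
      using g g0 that I J by (simp add: K_def act_inv flip: act_act)
    with g g0 show ?thesis by blast
  qed
  then show ?thesis unfolding tuple_equiv_iff[OF order_refl] by blast
qed

text \<open>The triples \<open>(a, b, c)\<close> and \<open>(a, b, d)\<close> rule out the value 2:
  omitting the first, second or third position, they are matched by \<open>h\<close>,
  \<open>g\<close> and the identity respectively.\<close>

lemma relational_complexity_eq_3:
  assumes \<Omega>: "a \<in> \<Omega>" "b \<in> \<Omega>" "c \<in> \<Omega>" "d \<in> \<Omega>"
    and g: "g \<in> carrier G" "act a g = a" "act c g = d"
    and h: "h \<in> carrier G" "act b h = b" "act c h = d"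
    and no: "\<not> (\<exists>k\<in>carrier G. act a k = a \<and> act b k = b \<and> act c k = d)"
  shows "relational_complexity G \<Omega> act = 3"
  unfolding relational_complexity_def
proof (rule Least_equality, intro conjI allI impI ballI)
  show "tuple_equiv G act m m I J"
    if "3 \<le> m" "I \<in> {1..m} \<rightarrow>\<^sub>E \<Omega>" "J \<in> {1..m} \<rightarrow>\<^sub>E \<Omega>" "tuple_equiv G act m 3 I J" for m I J
    using that by (intro tuple_equiv_3_imp) auto
next
  fix k assume k: "2 \<le> k \<and> (\<forall>m\<ge>k. \<forall>I\<in>{1..m} \<rightarrow>\<^sub>E \<Omega>. \<forall>J\<in>{1..m} \<rightarrow>\<^sub>E \<Omega>.
          tuple_equiv G act m k I J \<longrightarrow> tuple_equiv G act m m I J)"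
  define I where "I x = (\<lambda>i\<in>{1..3::nat}. if i = 1 then a else if i = 2 then b else x)" for x
  have I: "I x 1 = a" "I x 2 = b" "I x 3 = x" for x by (simp_all add: I_def)
  have two_le_3: "2 \<le> (3::nat)" by simp
  have two: "tuple_equiv G act 3 2 (I c) (I d)"
    unfolding tuple_equiv_iff[OF two_le_3]
  proof (intro allI impI)
    fix P :: "nat set" assume P: "P \<subseteq> {1..3}" "card P \<le> 2"
    have "\<not> {1..3} \<subseteq> P"
    proof
      assume "{1..3} \<subseteq> P"
      with P(1) have "P = {1..3}" by (rule equalityI)
      with P(2) show False by simp
    qed
    then obtain j where j: "j \<in> {1..3}" "j \<notin> P" by blast
    have eq: "{1..3} = {1, 2, 3::nat}" by (auto simp: eval_nat_numeral le_Suc_eq)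
    have "P \<subseteq> {2, 3} \<or> P \<subseteq> {1, 3} \<or> P \<subseteq> {1, 2}"
      using j P(1) unfolding eq by blast
    then consider "P \<subseteq> {2, 3}" | "P \<subseteq> {1, 3}" | "P \<subseteq> {1, 2}" by blast
    then show "\<exists>g\<in>carrier G. \<forall>i\<in>P. act (I c i) g = I d i"
    proof cases
      case 1
      then have "\<forall>i\<in>P. act (I c i) h = I d i" using h I by auto
      then show ?thesis using h(1) by blast
    next
      case 2
      then have "\<forall>i\<in>P. act (I c i) g = I d i" using g I by auto
      then show ?thesis using g(1) by blast
    next
      case 3
      then have "\<forall>i\<in>P. act (I c i) \<one> = I d i" using \<Omega> I act_1 by auto
      then show ?thesis using one_closed by blast
    qed
  qed
  have three: "\<not> tuple_equiv G act 3 3 (I c) (I d)"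
  proof
    assume "tuple_equiv G act 3 3 (I c) (I d)"
    then obtain k where k: "k \<in> carrier G" "\<And>i. i \<in> {1..3} \<Longrightarrow> act (I c i) k = I d i"
      unfolding tuple_equiv_iff[OF order_refl]
      by (metis order_refl card_atLeastAtMost diff_Suc_1 numeral_3_eq_3)
    have "act (I c 1) k = I d 1" "act (I c 2) k = I d 2" "act (I c 3) k = I d 3"
      using k(2) by simp_all
    then show False using no k(1) unfolding I by blast
  qed
  have "I c \<in> {1..3} \<rightarrow>\<^sub>E \<Omega>" "I d \<in> {1..3} \<rightarrow>\<^sub>E \<Omega>" using \<Omega> by (auto simp: I_def)
  then have "k \<noteq> 2" using k two three by auto
  then show "3 \<le> k" using k by simp
qed simp

end


section \<open>Projective action of matrices\<close>

lemmas vec4_simps = vec_eq_iff forall_4 matrix_matrix_mult_def vector_matrix_mult_def mat_def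
  transpose_def sum_4 vector_4_nth

text \<open>For nonzero \<open>v\<close> this encodes a projective point as the set of its nonzero
  representatives, so that matrices act by taking images. Vectors are rows, which makes the action a
  right action.\<close>

definition line :: "'a::field^'n \<Rightarrow> ('a^'n) set" where
  "line v = {k *s v | k. k \<noteq> 0}"

definition proj_act :: "('a::field^'n) set \<Rightarrow> 'a^'n^'n \<Rightarrow> ('a^'n) set" where
  "proj_act P A = (\<lambda>v. v v* A) ` P"

lemma line_eq_iff: "line v = line w \<longleftrightarrow> (\<exists>k. k \<noteq> 0 \<and> w = k *s v)"
proof
  assume "line v = line w"
  moreover have "w \<in> line w" unfolding line_def by (auto intro!: exI[of _ 1])
  ultimately show "\<exists>k. k \<noteq> 0 \<and> w = k *s v" unfolding line_def by auto
next
  assume "\<exists>k. k \<noteq> 0 \<and> w = k *s v"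
  then obtain k where k: "k \<noteq> 0" "w = k *s v" by blast
  have "\<exists>j. l *s v = j *s w \<and> j \<noteq> 0" if "l \<noteq> 0" for l
    using k that by (intro exI[of _ "l / k"]) simp
  then show "line v = line w"
    using k unfolding line_def by auto
qed

lemma proj_act_line:
  fixes v :: "'a::field^'n"
  shows "proj_act (line v) A = line (v v* A)"
proof -
  have "line u = (\<lambda>k. k *s u) ` (UNIV - {0})" for u :: "'a^'n"
    by (auto simp: line_def)
  then show ?thesis
    by (simp only: proj_act_def image_image scalar_vector_matrix_assoc)
qed

lemma proj_act_mult: "proj_act (proj_act P A) B = proj_act P (A ** B)"
  by (simp add: proj_act_def image_image vector_matrix_mul_assoc)

lemma proj_act_one: "proj_act P (mat 1) = P"
  by (simp add: proj_act_def)


section \<open>The automorphism \<open>\<theta>\<close> in characteristic 2\<close>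

text \<open>The argument \<open>field_type\<close> only carries the type \<open>'a\<close>, so that
  an instance determines the field.\<close>

locale suzuki_field =
  fixes e :: nat and field_type :: "'a::{field,finite} itself"
  assumes odd_e: "odd e" and e_gt_1: "e > 1" and card_field: "CARD('a) = 2 ^ e"
begin

text \<open>Multiplication by a nonzero \<open>x\<close> permutes the nonzero elements; comparing
  their products gives Fermat's identity.\<close>

lemma power_card: "(x::'a) ^ 2 ^ e = x"
proof (cases "x = 0")
  case False
  let ?U = "UNIV - {0::'a}"
  have "(\<Prod>y\<in>?U. x * y) = \<Prod>?U"
    by (rule prod.reindex_bij_witness[of _ "\<lambda>y. y / x" "\<lambda>y. x * y"]) (use False in auto)
  then have "x ^ card ?U * \<Prod>?U = \<Prod>?U"
    by (simp add: prod.distrib)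
  then have "x ^ card ?U = 1" by simp
  moreover have "2 ^ e = Suc (card ?U)"
    unfolding card_field[symmetric] by (simp add: card_Suc_Diff1 del: card_Diff_insert)
  ultimately show ?thesis by (simp del: card_Diff_insert)
qed simp

text \<open>Translation by 1 permutes the field, so comparing sums gives \<open>2 ^ e = 0\<close> in
  it.\<close>

lemma char_2: "(x::'a) + x = 0"
proof -
  have "(\<Sum>y\<in>UNIV. 1 + y) = \<Sum>(UNIV :: 'a set)"
    by (rule sum.reindex_bij_witness[of _ "\<lambda>y. y - 1" "\<lambda>y. 1 + y"]) auto
  then have "(2::'a) ^ e = 0"
    using card_field by (simp add: sum.distrib)
  then have "(2::'a) = 0" by simp
  then show ?thesis by (metis mult_2 mult_zero_left)
qed

lemma char_2': "(x::'a) + (x + y) = y"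
  by (simp add: char_2 flip: add.assoc)

lemma minus_char_2: "- (x::'a) = x"
  by (simp add: char_2 minus_unique)

lemma diff_char_2: "(x::'a) - y = x + y"
  using minus_char_2[of y] by (metis diff_conv_add_uminus)

lemmas char2 = char_2 char_2' minus_char_2 diff_char_2

lemma power2_add: "((x::'a) + y)\<^sup>2 = x\<^sup>2 + y\<^sup>2"
  by (simp add: power2_eq_square algebra_simps char2)

lemma power2_inj: "(x::'a)\<^sup>2 = y\<^sup>2 \<longleftrightarrow> x = y"
proof -
  have "x\<^sup>2 = y\<^sup>2 \<longleftrightarrow> (x + y)\<^sup>2 = 0"
    by (metis power2_add char_2 char_2' add_0_right)
  then show ?thesis by (metis char_2 char_2' add_0_right zero_eq_power2)
qed

abbreviation \<theta> :: "'a \<Rightarrow> 'a" where "\<theta> \<equiv> suzuki_theta e"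

lemma theta_add: "\<theta> (x + y) = \<theta> x + \<theta> y"
proof -
  have "(x + y) ^ 2 ^ n = x ^ 2 ^ n + y ^ 2 ^ n" for n
    by (induction n) (simp_all add: power2_add power_mult mult.commute[of 2])
  then show ?thesis unfolding suzuki_theta_def .
qed

lemma theta_simps:
  "\<theta> 0 = 0" "\<theta> 1 = 1" "\<theta> (x * y) = \<theta> x * \<theta> y" "\<theta> (inverse x) = inverse (\<theta> x)"
  "\<theta> (x / y) = \<theta> x / \<theta> y" "\<theta> x = 0 \<longleftrightarrow> x = 0"  "\<theta> (x ^ k) = \<theta> x ^ k"
  by (simp_all add: suzuki_theta_def power_mult_distrib power_inverse power_divide
     flip: power_mult power_Suc) (simp_all add: mult.commute)

text \<open>For odd \<open>e\<close> the exponents multiply to \<open>2 ^ (e + 1)\<close>, and the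
  \<open>2 ^ e\<close>-th power is the identity.\<close>

lemma theta_theta: "\<theta> (\<theta> x) = x\<^sup>2"
proof -
  have "2 ^ (e div 2 + 1) * 2 ^ (e div 2 + 1) = (2 ^ e * 2 :: nat)"
    using odd_e by (auto elim!: oddE simp flip: power_add power_Suc2 intro!: arg_cong[of _ _ "(^) 2"])
  then show ?thesis
    by (simp only: suzuki_theta_def power_card flip: power_mult) (simp only: power_mult power_card)
qed

lemma theta_square: "(x ^ 2 ^ (e div 2))\<^sup>2 = \<theta> x"
  by (simp add: suzuki_theta_def mult.commute flip: power_mult)

lemma exists_not_0_1: "\<exists>x::'a. x \<noteq> 0 \<and> x \<noteq> 1"
proof (rule ccontr)
  assume "\<not> ?thesis"
  then have "(UNIV::'a set) = {0, 1}" by auto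
  then have "CARD('a) \<le> 2" by (metis card_2_iff zero_neq_one order_refl)
  moreover have "2 ^ 2 \<le> (2 ^ e :: nat)"
    using e_gt_1 by (intro power_increasing) auto
  ultimately show False using card_field by simp
qed

text \<open>The graph of this function is the affine part of the Suzuki--Tits ovoid.\<close>

definition height :: "'a \<Rightarrow> 'a \<Rightarrow> 'a" where
  "height x y = x * y + x\<^sup>2 * \<theta> x + \<theta> y"

text \<open>With \<open>h = height x y\<close> nonzero, division by
  \<open>h\<^sup>2 * \<theta> h\<close> turns this into
  \<open>height (y / h) (x / h) = 1 / h\<close>, which makes the ovoid invariant under
  \<open>suzuki_T\<close>. At \<open>h = 0\<close> it forces \<open>y = 0\<close>.\<close>

lemma height_theta: "height x y * \<theta> (height x y) =
    x * y * \<theta> (height x y) + y\<^sup>2 * \<theta> y + \<theta> x * (height x y)\<^sup>2"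
  unfolding height_def
  by (simp add: theta_add theta_simps theta_theta power2_eq_square algebra_simps char2)

lemma height_eq_0: "height x y = 0 \<longleftrightarrow> x = 0 \<and> y = 0"
proof
  assume h: "height x y = 0"
  with height_theta[of x y] have "y = 0" by (simp add: theta_simps)
  with h show "x = 0 \<and> y = 0" by (simp add: height_def theta_simps)
qed (simp add: height_def theta_simps)

section \<open>The Suzuki--Tits ovoid\<close>

definition infinity :: "('a^4) set" where
  "infinity = line (vector [1, 0, 0, 0])"

definition affine_point :: "'a \<Rightarrow> 'a \<Rightarrow> ('a^4) set" where
  "affine_point x y = line (vector [height x y, y, x, 1])"

definition ovoid :: "('a^4) set set" where
  "ovoid = insert infinity (range (case_prod affine_point))"

lemma affine_point_eq_iff: "affine_point x y = affine_point x' y' \<longleftrightarrow> x = x' \<and> y = y'"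
  by (auto simp: affine_point_def line_eq_iff vec4_simps)

lemma affine_point_neq_infinity: "affine_point x y \<noteq> infinity" "infinity \<noteq> affine_point x y"
  by (auto simp: affine_point_def infinity_def line_eq_iff vec4_simps)

lemmas point_simps = affine_point_eq_iff affine_point_neq_infinity

lemma ovoid_simps: "infinity \<in> ovoid" "affine_point x y \<in> ovoid"
  by (auto simp: ovoid_def)

lemma ovoidE:
  assumes "P \<in> ovoid"
  obtains "P = infinity" | x y where "P = affine_point x y"
  using assms by (auto simp: ovoid_def)

lemma finite_ovoid: "finite ovoid"
  by (simp add: ovoid_def)

lemma card_ovoid: "card ovoid = (2 ^ e)\<^sup>2 + 1"
proof -
  have "inj (case_prod affine_point)"
    by (auto simp: inj_on_def point_simps)
  then have "card (range (case_prod affine_point)) = (2 ^ e)\<^sup>2"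
    by (simp add: card_image card_cartesian_product card_field power2_eq_square
      flip: UNIV_Times_UNIV)
  then show ?thesis
    unfolding ovoid_def by (subst card_insert_disjoint) (auto simp: point_simps)
qed

lemma act_S:
  "proj_act infinity (suzuki_S e a b) = infinity"
  "proj_act (affine_point x y) (suzuki_S e a b) = affine_point (x + a) (y + x * \<theta> a + a * \<theta> a + b)"
  unfolding infinity_def affine_point_def proj_act_line
  by (rule arg_cong[of _ _ line];
      simp add: vec4_simps suzuki_S_def height_def theta_simps theta_add theta_theta
        power2_eq_square algebra_simps char2)+

lemma act_M:
  assumes "c \<noteq> 0"
  shows "proj_act infinity (suzuki_M e c) = infinity"
    and "proj_act (affine_point x y) (suzuki_M e c) = affine_point (c * x) (c * \<theta> c * y)"
proof -
  \<comment> \<open>This is the square root of \<open>\<theta> c\<close>; the image vector is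
    normalised to last coordinate 1 by the factor \<open>c * s\<close>.\<close>
  define s where "s = c ^ 2 ^ (e div 2)"
  have s: "s \<noteq> 0" "\<theta> c = s * s"
    using assms by (simp_all add: s_def flip: power2_eq_square theta_square)
  have cancel: "inverse c * inverse s * (c * s) = 1"
    using assms s(1) by (simp add: mult.assoc mult.left_commute)
  then have cancel': "c * (s * (inverse c * inverse s)) = 1"
    by (simp only: mult_ac)
  have M: "suzuki_M e c = vector [vector [c * s, 0, 0, 0], vector [0, s, 0, 0],
      vector [0, 0, inverse s, 0], vector [0, 0, 0, inverse (c * s)]]"
    by (simp add: suzuki_M_def s_def)
  show "proj_act infinity (suzuki_M e c) = infinity"
    unfolding infinity_def proj_act_line line_eq_iff using assms s
    by (intro exI[of _ "inverse (c * s)"]) (simp add: M vec4_simps cancel)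
  show "proj_act (affine_point x y) (suzuki_M e c) = affine_point (c * x) (c * \<theta> c * y)"
    unfolding affine_point_def proj_act_line line_eq_iff using assms s theta_theta[of c]
    by (intro exI[of _ "c * s"])
      (simp add: M vec4_simps height_def theta_simps power2_eq_square algebra_simps cancel')
qed

text \<open>Reversing the coordinates sends \<open>(h, y, x, 1)\<close> to
  \<open>(1, x, y, h)\<close>, where \<open>h\<close> is the height; division by \<open>h\<close>
  gives an affine point by \<open>height_theta\<close>.\<close>

lemma act_T:
  "proj_act infinity suzuki_T = affine_point 0 0"
  "proj_act (affine_point 0 0) suzuki_T = infinity"
  "(x, y) \<noteq> (0, 0) \<Longrightarrow>
    proj_act (affine_point x y) suzuki_T = affine_point (y / height x y) (x / height x y)"
proof -
  show "proj_act infinity suzuki_T = affine_point 0 0" "proj_act (affine_point 0 0) suzuki_T = infinity"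
    unfolding infinity_def affine_point_def proj_act_line
    by (rule arg_cong[of _ _ line]; simp add: vec4_simps suzuki_T_def height_def theta_simps)+
  assume "(x, y) \<noteq> (0, 0)"
  then have h: "height x y \<noteq> 0" by (auto simp: height_eq_0)
  then have "height (y / height x y) (x / height x y) = 1 / height x y"
    using arg_cong[OF height_theta[of x y], of "\<lambda>z. z / ((height x y)\<^sup>2 * \<theta> (height x y))"]
    unfolding height_def[of "_ / _"]
    by (simp add: theta_simps add_divide_distrib power2_eq_square mult_ac)
  then show "proj_act (affine_point x y) suzuki_T = affine_point (y / height x y) (x / height x y)"
    unfolding affine_point_def proj_act_line line_eq_iff using h
    by (intro exI[of _ "1 / height x y"]) (simp add: vec4_simps suzuki_T_def)
qed

section \<open>Linear substitutions that scale the height\<close>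

text \<open>
  At \<open>1\<close>, \<open>w\<close> and \<open>1 + w\<close> the additive left-hand side takes the same value \<open>c\<close>, so \<open>c = c + c = 0\<close>.
\<close>

lemma affine_form_eq_0:
  assumes "\<And>v. v \<noteq> 0 \<Longrightarrow> a * \<theta> v + b * v\<^sup>2 = c"
  shows "a = 0" "b = 0" "c = 0"
proof -
  obtain w :: 'a where w: "w \<noteq> 0" "w \<noteq> 1" using exists_not_0_1 by blast
  have w1: "1 + w \<noteq> 0" using w(2) char_2' by (metis add.right_neutral)
  have "a * \<theta> (1 + w) + b * (1 + w)\<^sup>2 = (a * \<theta> 1 + b * 1\<^sup>2) + (a * \<theta> w + b * w\<^sup>2)"
    by (simp add: theta_add power2_add algebra_simps)
  also have "\<dots> = 0"
    using assms[of 1] assms[of w] w by (simp add: char2)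
  finally show c: "c = 0" using assms[OF w1] by simp
  have ab: "a = b"
    using assms[of 1] c by (simp add: theta_simps) (metis char_2' add.right_neutral)
  \<comment> \<open>If \<open>a = b\<close> were nonzero, vanishing at \<open>w\<close> would give
    \<open>\<theta> w = w\<^sup>2\<close>. Applying \<open>\<theta>\<close> again yields
    \<open>w\<^sup>2 = (w\<^sup>2)\<^sup>2\<close>, so \<open>w\<close> would be 0 or 1.\<close>
  have "a = 0"
  proof (rule ccontr)
    assume "a \<noteq> 0"
    have "a * (\<theta> w + w\<^sup>2) = 0" using assms[OF w(1)] c ab by (simp add: algebra_simps)
    then have t: "\<theta> w = w\<^sup>2"
      using \<open>a \<noteq> 0\<close> by simp (metis char_2' add.right_neutral)
    then have "\<theta> (\<theta> w) = (w\<^sup>2)\<^sup>2" by (simp add: theta_simps)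
    then have "w = w\<^sup>2" unfolding theta_theta power2_inj .
    then show False using w by (simp add: power2_eq_square)
  qed
  with ab show "a = 0" "b = 0" by simp_all
qed

text \<open>Restricting to the two axes, at the coordinate \<open>1 / v\<close>, and clearing
  denominators by \<open>v\<^sup>2 * \<theta> v\<close> gives two identities of the form treated in
  \<open>affine_form_eq_0\<close>.\<close>

lemma height_similarity:
  assumes "\<And>x y. height (Q * y + S * x) (P * y + R * x) = k * height x y"
  shows "Q = 0" "R = 0" "\<theta> P = k"
proof -
  have "(Q * P) * \<theta> v + (\<theta> P + k) * v\<^sup>2 = Q\<^sup>2 * \<theta> Q" if "v \<noteq> 0" for v
  proof -
    define w where "w = inverse v"
    have w: "w * v = 1" "\<theta> w * \<theta> v = 1"
      using that by (simp_all add: w_def theta_simps)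
    have "height (Q * w) (P * w) = k * height 0 w"
      using assms[of w 0] by simp
    then have "(Q * w) * (P * w) + (Q * w)\<^sup>2 * (\<theta> Q * \<theta> w) + \<theta> P * \<theta> w = k * \<theta> w"
      by (simp add: height_def theta_simps)
    note eq = this
    have "Q * P * \<theta> v + Q\<^sup>2 * \<theta> Q + \<theta> P * v\<^sup>2 =
        Q * P * (w * v)\<^sup>2 * \<theta> v + Q\<^sup>2 * \<theta> Q * (w * v)\<^sup>2 * (\<theta> w * \<theta> v) + \<theta> P * v\<^sup>2 * (\<theta> w * \<theta> v)"
      by (simp only: w) simp
    also have "\<dots> = ((Q * w) * (P * w) + (Q * w)\<^sup>2 * (\<theta> Q * \<theta> w) + \<theta> P * \<theta> w) * (v\<^sup>2 * \<theta> v)"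
      by (simp add: algebra_simps power2_eq_square)
    also have "\<dots> = k * v\<^sup>2 * (\<theta> w * \<theta> v)"
      unfolding eq by (simp add: mult_ac)
    finally have "Q * P * \<theta> v + Q\<^sup>2 * \<theta> Q + \<theta> P * v\<^sup>2 = k * v\<^sup>2"
      by (simp add: w)
    note eq = this
    have "Q * P * \<theta> v + (\<theta> P + k) * v\<^sup>2 =
        (Q * P * \<theta> v + Q\<^sup>2 * \<theta> Q + \<theta> P * v\<^sup>2) + k * v\<^sup>2 + Q\<^sup>2 * \<theta> Q"
      by (simp add: algebra_simps char2)
    also have "\<dots> = Q\<^sup>2 * \<theta> Q"
      unfolding eq by (simp add: char2)
    finally show ?thesis .
  qed
  from affine_form_eq_0[OF this] show "Q = 0" "\<theta> P = k"
    by (simp_all add: theta_simps) (metis char_2' add.right_neutral)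
  have "(S * R) * \<theta> v + \<theta> R * v\<^sup>2 = k + S\<^sup>2 * \<theta> S" if "v \<noteq> 0" for v
  proof -
    have "height (S / v) (R / v) = k * height (1 / v) 0"
      using assms[of 0 "1 / v"] by simp
    then have "S * R * \<theta> v + S\<^sup>2 * \<theta> S + \<theta> R * v\<^sup>2 = k"
      using that by (simp add: height_def theta_simps field_simps power2_eq_square)
    note eq = this
    have "S * R * \<theta> v + \<theta> R * v\<^sup>2 =
        (S * R * \<theta> v + S\<^sup>2 * \<theta> S + \<theta> R * v\<^sup>2) + S\<^sup>2 * \<theta> S"
      by (simp add: algebra_simps char2)
    then show ?thesis unfolding eq .
  qed
  from affine_form_eq_0[OF this] show "R = 0" by (simp add: theta_simps)
qed

section \<open>Stabilisers of two and three points of the ovoid\<close>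

text \<open>
  \<open>suzuki_T\<close> doubles as the Gram matrix of an alternating form. Invariance of this form makes a matrix
  fixing the lines of \<open>e\<^sub>1\<close> and \<open>e\<^sub>4\<close> also preserve their perpendicular \<open>\<langle>e\<^sub>2, e\<^sub>3\<rangle>\<close>.
\<close>

definition ovoid_isometry :: "'a^4^4 \<Rightarrow> bool" where
  "ovoid_isometry A \<longleftrightarrow> A ** suzuki_T ** transpose A = suzuki_T \<and> (\<forall>P\<in>ovoid. proj_act P A \<in> ovoid)"

text \<open>The form reduces the matrix to two corner entries and a middle 2-by-2 block. Invariance
  of the ovoid then says that the block scales the height, which determines it by
  \<open>height_similarity\<close>.\<close>

lemma ovoid_isometry_torus:
  assumes A: "ovoid_isometry A"
    and fix_inf: "proj_act infinity A = infinity"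
    and fix_0: "proj_act (affine_point 0 0) A = affine_point 0 0"
  obtains l where "l \<noteq> 0" "A = vector [vector [l, 0, 0, 0], vector [0, \<theta> l / l, 0, 0],
      vector [0, 0, l / \<theta> l, 0], vector [0, 0, 0, 1 / l]]"
proof -
  define l where "l = A $ 1 $ 1"
  have row1: "l \<noteq> 0" "A $ 1 $ 2 = 0" "A $ 1 $ 3 = 0" "A $ 1 $ 4 = 0"
    using fix_inf[symmetric] unfolding infinity_def proj_act_line line_eq_iff
    by (auto simp: vec4_simps l_def)
  have row4: "A $ 4 $ 1 = 0" "A $ 4 $ 2 = 0" "A $ 4 $ 3 = 0" "A $ 4 $ 4 \<noteq> 0"
    using fix_0[symmetric] unfolding affine_point_def proj_act_line line_eq_iff
    by (auto simp: vec4_simps height_def theta_simps)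
  have form: "\<forall>i j. (A ** suzuki_T ** transpose A) $ i $ j = suzuki_T $ i $ j"
    using A by (simp add: ovoid_isometry_def)
  \<comment> \<open>Row 1 paired with row 4 gives the last entry, rows 2 and 3 paired with rows 1
    and 4 give the zeros, and row 2 paired with row 3 gives the determinant of the block in
    characteristic 2.\<close>
  have m: "A $ 4 $ 4 = 1 / l"
    and zeros: "A $ 2 $ 4 = 0" "A $ 3 $ 4 = 0" "A $ 2 $ 1 = 0" "A $ 3 $ 1 = 0"
    and det: "A $ 2 $ 2 * A $ 3 $ 3 + A $ 2 $ 3 * A $ 3 $ 2 = 1"
    using form row1 row4 by (auto simp: suzuki_T_def vec4_simps l_def field_simps)
  have "height (l * A $ 2 $ 3 * y + l * A $ 3 $ 3 * x) (l * A $ 2 $ 2 * y + l * A $ 3 $ 2 * x)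
      = l\<^sup>2 * height x y" for x y
  proof -
    have "proj_act (affine_point x y) A \<in> ovoid"
      using A by (auto simp: ovoid_isometry_def ovoid_simps)
    then show ?thesis
    proof (cases rule: ovoidE)
      case 1
      then show ?thesis
        unfolding affine_point_def infinity_def proj_act_line line_eq_iff
        using row1 row4 zeros by (auto simp: vec4_simps)
    next
      case (2 x' y')
      then obtain k where k: "k \<noteq> 0"
        "vector [height x' y', y', x', 1] = k *s (vector [height x y, y, x, 1] v* A)"
        unfolding affine_point_def proj_act_line line_eq_iff by blast
      \<comment> \<open>The last coordinate of the image vector is \<open>1 / l\<close>, so the
        normalising factor is \<open>l\<close>.\<close>
      from k have "k = l" "x' = l * A $ 2 $ 3 * y + l * A $ 3 $ 3 * x"
        "y' = l * A $ 2 $ 2 * y + l * A $ 3 $ 2 * x" "height x' y' = l\<^sup>2 * height x y"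
        using row1 row4 zeros m
        by (auto simp: vec4_simps l_def algebra_simps power2_eq_square)
      then show ?thesis by simp
    qed
  qed
  note sim = height_similarity[OF this]
  have off: "A $ 2 $ 3 = 0" "A $ 3 $ 2 = 0" using sim row1 by auto
  have "(l * A $ 2 $ 2)\<^sup>2 = (\<theta> l)\<^sup>2"
    using sim(3) theta_theta[of "l * A $ 2 $ 2"] by (simp add: theta_simps)
  then have "l * A $ 2 $ 2 = \<theta> l" by (simp add: power2_inj)
  then have p: "A $ 2 $ 2 = \<theta> l / l" using row1 by (simp add: field_simps)
  have "A $ 3 $ 3 = l / \<theta> l"
    using det off p row1 by (simp add: field_simps theta_simps)
  with p off zeros row1 row4 m show ?thesis
    by (intro that[of l]) (auto simp: vec4_simps l_def)
qed

text \<open>A torus element with parameter \<open>l\<close> that fixes a further point satisfies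
  \<open>\<theta> l = 1\<close> or \<open>\<theta> l = l\<^sup>2\<close>; either equation forces
  \<open>l = 1\<close>.\<close>

lemma ovoid_isometry_fix3:
  assumes A: "ovoid_isometry A" "proj_act infinity A = infinity" "proj_act (affine_point 0 0) A = affine_point 0 0"
    and P: "P \<in> ovoid" "P \<noteq> infinity" "P \<noteq> affine_point 0 0" "proj_act P A = P"
  shows "A = mat 1"
proof -
  obtain l where l: "l \<noteq> 0" and Al: "A = vector [vector [l, 0, 0, 0], vector [0, \<theta> l / l, 0, 0],
      vector [0, 0, l / \<theta> l, 0], vector [0, 0, 0, 1 / l]]"
    using ovoid_isometry_torus[OF A] .
  have tl: "\<theta> l \<noteq> 0" using l by (simp add: theta_simps)
  obtain x y where xy: "P = affine_point x y" "x \<noteq> 0 \<or> y \<noteq> 0"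
    using P by (auto elim!: ovoidE simp: point_simps)
  obtain k where "vector [height x y, y, x, 1] = k *s (vector [height x y, y, x, 1] v* A)"
    using P(4) unfolding xy affine_point_def proj_act_line line_eq_iff by blast
  then have "k = l" "y = k * y * (\<theta> l / l)" "x = k * x * (l / \<theta> l)"
    using l by (auto simp: vec4_simps Al field_simps)
  then have y: "y = y * \<theta> l" and x: "x * \<theta> l = x * l\<^sup>2"
    using l tl by (auto simp: field_simps power2_eq_square)
  have "l = 1"
  proof (cases "y = 0")
    case False
    then have "\<theta> l = 1" using y by simp
    then have "l\<^sup>2 = 1\<^sup>2" using theta_theta[of l] by (simp add: theta_simps)
    then show ?thesis by (simp only: power2_inj)
  next
    case True
    then have t: "\<theta> l = l\<^sup>2" using x xy by simp
    then have "\<theta> (\<theta> l) = (l\<^sup>2)\<^sup>2" by (simp add: theta_simps)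
    then have "l = l\<^sup>2" unfolding theta_theta power2_inj .
    then show ?thesis using l by (simp add: power2_eq_square)
  qed
  then show ?thesis by (simp add: Al vec4_simps theta_simps)
qed

text \<open>The corner entry satisfies \<open>l\<^sup>2 = 1\<close>, and squaring is injective in
  characteristic 2.\<close>

lemma ovoid_isometry_involution:
  assumes A: "ovoid_isometry A" "proj_act infinity A = infinity" "proj_act (affine_point 0 0) A = affine_point 0 0"
    and sq: "A ** A = mat 1"
  shows "A = mat 1"
proof -
  obtain l where l: "l \<noteq> 0" and Al: "A = vector [vector [l, 0, 0, 0], vector [0, \<theta> l / l, 0, 0],
      vector [0, 0, l / \<theta> l, 0], vector [0, 0, 0, 1 / l]]"
    using ovoid_isometry_torus[OF A] .
  have "(A ** A) $ 1 $ 1 = 1" using sq by (simp add: mat_def)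
  then have "l\<^sup>2 = 1\<^sup>2" by (simp add: Al vec4_simps power2_eq_square)
  then have "l = 1" by (simp only: power2_inj)
  then show ?thesis by (simp add: Al vec4_simps theta_simps)
qed


section \<open>The action of the Suzuki group\<close>

abbreviation Sz :: "('a^4^4) monoid" where "Sz \<equiv> suzuki_group e"

interpretation Sz: group Sz by (rule group_suzuki_group)

lemma mult_Sz: "A \<otimes>\<^bsub>Sz\<^esub> B = A ** B" and one_Sz: "\<one>\<^bsub>Sz\<^esub> = mat 1"
  by (simp_all add: suzuki_group_def subgroup_generated_def general_linear_group_def)

lemma generators_in_Sz:
  "suzuki_S e a b \<in> carrier Sz" "c \<noteq> 0 \<Longrightarrow> suzuki_M e c \<in> carrier Sz" "suzuki_T \<in> carrier Sz"
proof -
  have "suzuki_generators e \<subseteq> carrier Sz"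
    unfolding suzuki_group_def
    by (rule group.subgroup_generated_subset_carrier_subset[OF group_general_linear_group
          suzuki_generators_subset])
  then show "suzuki_S e a b \<in> carrier Sz" "c \<noteq> 0 \<Longrightarrow> suzuki_M e c \<in> carrier Sz"
    "suzuki_T \<in> carrier Sz"
    by (auto simp: suzuki_generators_def)
qed

lemma ovoid_isometry_mult:
  assumes "ovoid_isometry A" "ovoid_isometry B"
  shows "ovoid_isometry (A ** B)"
proof -
  have "A ** B ** suzuki_T ** transpose (A ** B) = A ** (B ** suzuki_T ** transpose B) ** transpose A"
    by (simp add: matrix_transpose_mul matrix_mul_assoc)
  also have "\<dots> = suzuki_T" using assms by (simp add: ovoid_isometry_def)
  finally show ?thesis
    using assms unfolding ovoid_isometry_def by (simp flip: proj_act_mult)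
qed

text \<open>An injective map of the finite ovoid into itself is onto, so the inverse preserves the
  ovoid too.\<close>

lemma ovoid_isometry_inverse:
  assumes A: "ovoid_isometry A" and AB: "A ** B = mat 1" and BA: "B ** A = mat 1"
  shows "ovoid_isometry B"
proof -
  have "B ** suzuki_T ** transpose B = B ** (A ** suzuki_T ** transpose A) ** transpose B"
    using A by (simp add: ovoid_isometry_def)
  also have "\<dots> = (B ** A) ** suzuki_T ** transpose (B ** A)"
    by (simp only: matrix_transpose_mul matrix_mul_assoc)
  also have "\<dots> = suzuki_T" by (simp add: BA transpose_mat)
  finally have form: "B ** suzuki_T ** transpose B = suzuki_T" .
  have inj: "inj_on (\<lambda>P. proj_act P A) ovoid"
    by (rule inj_on_inverseI[of _ "\<lambda>P. proj_act P B"]) (simp add: proj_act_mult AB proj_act_one)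
  have "(\<lambda>P. proj_act P A) ` ovoid = ovoid"
    using A finite_ovoid inj by (intro endo_inj_surj) (auto simp: ovoid_isometry_def)
  then have "proj_act P B \<in> ovoid" if "P \<in> ovoid" for P
    using that by (metis (no_types, lifting) AB imageE proj_act_mult proj_act_one)
  with form show ?thesis by (simp add: ovoid_isometry_def)
qed

lemma ovoid_isometry_generators:
  assumes "A \<in> suzuki_generators e"
  shows "ovoid_isometry A"
proof -
  consider a b where "A = suzuki_S e a b" | c where "c \<noteq> 0" "A = suzuki_M e c" | "A = suzuki_T"
    using assms by (auto simp: suzuki_generators_def)
  then show ?thesis
  proof cases
    case 1
    have "A ** suzuki_T ** transpose A = suzuki_T"
      unfolding 1 by (simp add: vec4_simps suzuki_S_def suzuki_T_def algebra_simps power2_eq_square char2)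
    then show ?thesis
      by (auto simp: ovoid_isometry_def 1 act_S ovoid_simps elim!: ovoidE)
  next
    case 2
    have form: "D ** suzuki_T ** transpose D = suzuki_T"
      if "D = vector [vector [u, 0, 0, 0], vector [0, v, 0, 0],
          vector [0, 0, inverse v, 0], vector [0, 0, 0, inverse u]]" "u \<noteq> 0" "v \<noteq> 0"
      for D :: "'a^4^4" and u v
      using that(2,3) unfolding that(1) by (simp add: vec4_simps suzuki_T_def)
    have "A ** suzuki_T ** transpose A = suzuki_T"
      unfolding 2(2) by (rule form[OF suzuki_M_def]) (use 2(1) in simp_all)
    then show ?thesis
      using 2(1) by (auto simp: ovoid_isometry_def 2(2) act_M ovoid_simps elim!: ovoidE)
  next
    case 3
    have "A ** suzuki_T ** transpose A = suzuki_T"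
      unfolding 3 by (simp add: vec4_simps suzuki_T_def)
    moreover have "proj_act P A \<in> ovoid" if "P \<in> ovoid" for P
      using that
    proof (cases rule: ovoidE)
      case (2 x y)
      then show ?thesis using act_T(2,3) 3 by (cases "(x, y) = (0, 0)") (auto simp: ovoid_simps)
    qed (simp add: 3 act_T ovoid_simps)
    ultimately show ?thesis by (simp add: ovoid_isometry_def)
  qed
qed

lemma ovoid_isometry_Sz:
  assumes "A \<in> carrier Sz"
  shows "ovoid_isometry A"
proof -
  interpret GL: group "general_linear_group :: ('a^4^4) monoid" by (rule group_general_linear_group)
  have sub: "suzuki_generators e \<subseteq> carrier (general_linear_group :: ('a^4^4) monoid)"
    by (rule suzuki_generators_subset)
  \<comment> \<open>The construction \<open>subgroup_generated\<close> intersects the generating set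
    with the carrier; here all generators are invertible.\<close>
  have "A \<in> generate general_linear_group (suzuki_generators e)"
    using assms by (simp add: suzuki_group_def carrier_subgroup_generated Int_absorb1[OF sub])
  then show ?thesis
  proof induction
    case one
    then show ?case
      by (simp add: ovoid_isometry_def general_linear_group_def proj_act_one transpose_mat)
  next
    case (incl h)
    then show ?case by (rule ovoid_isometry_generators)
  next
    case (inv h)
    then have h: "h \<in> carrier general_linear_group" using suzuki_generators_subset by blast
    show ?case
    proof (rule ovoid_isometry_inverse)
      show "ovoid_isometry h" using inv by (rule ovoid_isometry_generators)
      show "h ** inv\<^bsub>general_linear_group\<^esub> h = mat 1" "inv\<^bsub>general_linear_group\<^esub> h ** h = mat 1"
        using GL.r_inv[OF h] GL.l_inv[OF h] by (simp_all add: general_linear_group_def)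
    qed
  next
    case (eng h1 h2)
    then show ?case by (simp add: general_linear_group_def ovoid_isometry_mult)
  qed
qed

section \<open>Two-transitivity and fixed points\<close>

lemma act_ovoid: "A \<in> carrier Sz \<Longrightarrow> P \<in> ovoid \<Longrightarrow> proj_act P A \<in> ovoid"
  using ovoid_isometry_Sz by (simp add: ovoid_isometry_def)

lemma act_inv:
  assumes "A \<in> carrier Sz"
  shows "proj_act (proj_act P A) (inv\<^bsub>Sz\<^esub> A) = P" "proj_act (proj_act P (inv\<^bsub>Sz\<^esub> A)) A = P"
  using Sz.r_inv[OF assms] Sz.l_inv[OF assms]
  by (simp_all add: proj_act_mult mult_Sz one_Sz proj_act_one)

lemma act_eq_iff:
  assumes "A \<in> carrier Sz"
  shows "proj_act P A = proj_act Q A \<longleftrightarrow> P = Q"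
  using act_inv(1)[OF assms] by metis

lemma transitive_affine:
  obtains g where "g \<in> carrier Sz" "proj_act infinity g = infinity"
    "proj_act (affine_point 0 0) g = affine_point x y"
  \<comment> \<open>The matrix \<open>suzuki_S e x b\<close> moves the origin to height parameters
    \<open>x\<close> and \<open>x * \<theta> x + b\<close>; the choice of \<open>b\<close> makes the
    second one \<open>y\<close>.\<close>
  by (rule that[of "suzuki_S e x (y + x * \<theta> x)"])
    (simp_all add: generators_in_Sz act_S point_simps algebra_simps char2)

text \<open>After \<open>infinity\<close> is moved to \<open>P\<close>, the second point is
  corrected inside the stabiliser of \<open>infinity\<close>, which is transitive on affine
  points.\<close>

lemma two_transitive:
  assumes "P \<in> ovoid" "Q \<in> ovoid" "P \<noteq> Q"
  obtains g where "g \<in> carrier Sz" "proj_act infinity g = P" "proj_act (affine_point 0 0) g = Q"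
proof -
  obtain g1 where g1: "g1 \<in> carrier Sz" "proj_act infinity g1 = P"
    using assms(1)
  proof (cases rule: ovoidE)
    case 1
    then show ?thesis using that[of "mat 1"] Sz.one_closed by (simp add: one_Sz proj_act_one)
  next
    case (2 x y)
    obtain s where "s \<in> carrier Sz" "proj_act (affine_point 0 0) s = affine_point x y"
      by (rule transitive_affine)
    then show ?thesis
      using 2 that[of "suzuki_T ** s"] Sz.m_closed[OF generators_in_Sz(3)]
      by (simp add: mult_Sz act_T flip: proj_act_mult)
  qed
  define Q' where "Q' = proj_act Q (inv\<^bsub>Sz\<^esub> g1)"
  have Q': "proj_act Q' g1 = Q" "Q' \<in> ovoid"
    using g1 assms(2) by (simp_all add: Q'_def act_inv act_ovoid)
  have "Q' \<noteq> infinity" using Q' g1 assms(3) by auto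
  then obtain x y where "Q' = affine_point x y" using ovoidE[OF Q'(2)] by metis
  then obtain s where s: "s \<in> carrier Sz" "proj_act infinity s = infinity"
    "proj_act (affine_point 0 0) s = Q'"
    using transitive_affine by metis
  then have "s ** g1 \<in> carrier Sz" using Sz.m_closed g1(1) by (simp flip: mult_Sz)
  then show ?thesis
    using s g1 Q' by (intro that[of "s ** g1"]) (simp_all flip: proj_act_mult)
qed

text \<open>Reduces statements about two arbitrary fixed points to the torus computation at
  \<open>infinity\<close> and the origin.\<close>

lemma conjugate_to_standard:
  assumes A: "A \<in> carrier Sz" and PQ: "P \<in> ovoid" "Q \<in> ovoid" "P \<noteq> Q"
    and fixed: "proj_act P A = P" "proj_act Q A = Q"
  obtains g where "g \<in> carrier Sz" "proj_act infinity g = P" "proj_act (affine_point 0 0) g = Q"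
    "ovoid_isometry (g ** A ** inv\<^bsub>Sz\<^esub> g)"
    "proj_act infinity (g ** A ** inv\<^bsub>Sz\<^esub> g) = infinity"
    "proj_act (affine_point 0 0) (g ** A ** inv\<^bsub>Sz\<^esub> g) = affine_point 0 0"
    "g ** A ** inv\<^bsub>Sz\<^esub> g = mat 1 \<Longrightarrow> A = mat 1"
proof -
  obtain g where g: "g \<in> carrier Sz" "proj_act infinity g = P" "proj_act (affine_point 0 0) g = Q"
    using two_transitive[OF PQ] .
  have "g \<otimes>\<^bsub>Sz\<^esub> A \<otimes>\<^bsub>Sz\<^esub> inv\<^bsub>Sz\<^esub> g \<in> carrier Sz" using A g by simp
  then have iso: "ovoid_isometry (g ** A ** inv\<^bsub>Sz\<^esub> g)" by (simp add: mult_Sz ovoid_isometry_Sz)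
  have "proj_act P (inv\<^bsub>Sz\<^esub> g) = infinity" "proj_act Q (inv\<^bsub>Sz\<^esub> g) = affine_point 0 0"
    using act_inv(1)[OF g(1)] g by auto
  moreover have "A = \<one>\<^bsub>Sz\<^esub>" if "g \<otimes>\<^bsub>Sz\<^esub> A \<otimes>\<^bsub>Sz\<^esub> inv\<^bsub>Sz\<^esub> g = \<one>\<^bsub>Sz\<^esub>"
    using Sz.inv_equality[OF that] A g(1) by (simp add: eq_commute[of g])
  ultimately show ?thesis
    using g fixed iso by (intro that[of g]) (simp_all add: mult_Sz one_Sz flip: proj_act_mult)
qed

lemma fix3:
  assumes "A \<in> carrier Sz" "P \<in> ovoid" "Q \<in> ovoid" "R \<in> ovoid" "P \<noteq> Q" "R \<noteq> P" "R \<noteq> Q"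
    and "proj_act P A = P" "proj_act Q A = Q" "proj_act R A = R"
  shows "A = mat 1"
proof -
  obtain g where g: "g \<in> carrier Sz" "proj_act infinity g = P" "proj_act (affine_point 0 0) g = Q"
    "ovoid_isometry (g ** A ** inv\<^bsub>Sz\<^esub> g)"
    "proj_act infinity (g ** A ** inv\<^bsub>Sz\<^esub> g) = infinity"
    "proj_act (affine_point 0 0) (g ** A ** inv\<^bsub>Sz\<^esub> g) = affine_point 0 0"
    "g ** A ** inv\<^bsub>Sz\<^esub> g = mat 1 \<Longrightarrow> A = mat 1"
    using conjugate_to_standard[of A P Q] assms by metis
  define R' where "R' = proj_act R (inv\<^bsub>Sz\<^esub> g)"
  have R': "proj_act R' g = R" using g(1) by (simp add: R'_def act_inv)
  have "proj_act R' (g ** A ** inv\<^bsub>Sz\<^esub> g) = R'"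
    using R' assms(10) by (simp add: R'_def flip: proj_act_mult)
  moreover have "R' \<in> ovoid" using g(1) assms(4) by (simp add: R'_def act_ovoid)
  moreover have "R' \<noteq> infinity" "R' \<noteq> affine_point 0 0" using R' g assms by auto
  ultimately show ?thesis
    using ovoid_isometry_fix3[OF g(4-6)] g(7) by blast
qed

lemma fix2_involution:
  assumes "A \<in> carrier Sz" "P \<in> ovoid" "Q \<in> ovoid" "P \<noteq> Q"
    and "proj_act P A = P" "proj_act Q A = Q" and sq: "A ** A = mat 1"
  shows "A = mat 1"
proof -
  obtain g where g: "g \<in> carrier Sz"
    "ovoid_isometry (g ** A ** inv\<^bsub>Sz\<^esub> g)"
    "proj_act infinity (g ** A ** inv\<^bsub>Sz\<^esub> g) = infinity"
    "proj_act (affine_point 0 0) (g ** A ** inv\<^bsub>Sz\<^esub> g) = affine_point 0 0"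
    "g ** A ** inv\<^bsub>Sz\<^esub> g = mat 1 \<Longrightarrow> A = mat 1"
    using conjugate_to_standard[of A P Q] assms by metis
  have gi: "inv\<^bsub>Sz\<^esub> g ** g = mat 1" "g ** inv\<^bsub>Sz\<^esub> g = mat 1"
    using Sz.l_inv[OF g(1)] Sz.r_inv[OF g(1)] by (simp_all add: mult_Sz one_Sz)
  have "(g ** A ** inv\<^bsub>Sz\<^esub> g) ** (g ** A ** inv\<^bsub>Sz\<^esub> g) =
      g ** A ** (inv\<^bsub>Sz\<^esub> g ** g) ** A ** inv\<^bsub>Sz\<^esub> g"
    by (simp only: matrix_mul_assoc)
  also have "\<dots> = g ** (A ** A) ** inv\<^bsub>Sz\<^esub> g"
    by (simp only: gi matrix_mul_rid) (simp only: matrix_mul_assoc)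
  also have "\<dots> = mat 1" by (simp add: sq gi)
  finally show ?thesis
    using ovoid_isometry_involution[OF g(2-4)] g(5) by blast
qed

section \<open>Pairs of points\<close>

definition pairs :: "('a^4) set set set" where
  "pairs = {E. E \<subseteq> ovoid \<and> card E = 2}"

definition pair_act :: "('a^4) set set \<Rightarrow> 'a^4^4 \<Rightarrow> ('a^4) set set" where
  "pair_act E A = (\<lambda>P. proj_act P A) ` E"

lemma pairsE:
  assumes "E \<in> pairs" "P \<in> E"
  obtains Q where "E = {P, Q}" "P \<noteq> Q" "P \<in> ovoid" "Q \<in> ovoid"
proof -
  have E: "E \<subseteq> ovoid" "card E = 2" using assms(1) by (simp_all add: pairs_def)
  from E(2) obtain x y where xy: "E = {x, y}" "x \<noteq> y" unfolding card_2_iff by blast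
  from assms(2) consider "P = x" | "P = y" unfolding xy by blast
  then show ?thesis
  proof cases
    case 1
    show ?thesis using that[of y] E(1) xy unfolding 1 by simp
  next
    case 2
    show ?thesis using that[of x] E(1) xy unfolding 2 by (simp add: insert_commute)
  qed
qed

lemma pairsI: "P \<in> ovoid \<Longrightarrow> Q \<in> ovoid \<Longrightarrow> P \<noteq> Q \<Longrightarrow> {P, Q} \<in> pairs"
  by (auto simp: pairs_def)

lemma pair_act_mult: "pair_act (pair_act E A) B = pair_act E (A ** B)"
  by (simp add: pair_act_def image_image proj_act_mult)

lemma pair_act_one: "pair_act E (mat 1) = E"
  by (simp add: pair_act_def proj_act_one)

lemma pair_act_inv:
  assumes "A \<in> carrier Sz"
  shows "pair_act (pair_act E A) (inv\<^bsub>Sz\<^esub> A) = E"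
  using act_inv[OF assms] by (simp add: pair_act_def image_image)

lemma pair_act_closed:
  assumes "A \<in> carrier Sz" "E \<in> pairs"
  shows "pair_act E A \<in> pairs"
proof -
  have "inj_on (\<lambda>P. proj_act P A) E" using act_eq_iff[OF assms(1)] by (auto simp: inj_on_def)
  then show ?thesis
    using assms act_ovoid[OF assms(1)] by (auto simp: pairs_def pair_act_def card_image)
qed

text \<open>Such an \<open>A\<close> fixes both points of \<open>E\<close>. A point of
  \<open>F\<close> outside \<open>E\<close> is either fixed, so that \<open>fix3\<close> applies, or
  swapped with its partner; then \<open>A ** A\<close> fixes three points and \<open>A\<close> is an
  involution or trivial, so \<open>fix2_involution\<close> applies.\<close>

lemma pair_fix:
  assumes A: "A \<in> carrier Sz" and E: "E \<in> pairs" "pair_act E A = E" "P \<in> E" "proj_act P A = P"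
    and F: "F \<in> pairs" "pair_act F A = F" "F \<noteq> E"
  shows "A = mat 1"
proof -
  obtain Q where Q: "E = {P, Q}" "P \<noteq> Q" "P \<in> ovoid" "Q \<in> ovoid" using E(1,3) by (rule pairsE)
  have "proj_act Q A \<in> {P, Q}" using E(2) Q(1) by (auto simp: pair_act_def)
  then have Qf: "proj_act Q A = Q" using Q(2) E(4) act_eq_iff[OF A, of Q P] by auto
  have "finite E" using Q(1) by simp
  then have "\<not> F \<subseteq> E"
    using card_subset_eq[of E F] E(1) F(1,3) unfolding pairs_def by auto
  then obtain R where R: "R \<in> F" "R \<notin> E" by blast
  obtain S where S: "F = {R, S}" "R \<noteq> S" "R \<in> ovoid" "S \<in> ovoid" using F(1) R(1) by (rule pairsE)
  have "proj_act R A \<in> {R, S}" "proj_act S A \<in> {R, S}" using F(2) S(1) by (auto simp: pair_act_def)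
  then consider "proj_act R A = R" | "proj_act R A = S" "proj_act S A = R"
    using S(2) act_eq_iff[OF A, of R S] by auto
  then show ?thesis
  proof cases
    case 1
    then show ?thesis using fix3[OF A Q(3,4) S(3) Q(2)] R(2) Q(1) E(4) Qf by blast
  next
    case 2
    have AA: "A ** A \<in> carrier Sz" using Sz.m_closed[OF A A] by (simp add: mult_Sz)
    have "proj_act P (A ** A) = P" "proj_act Q (A ** A) = Q" "proj_act R (A ** A) = R"
      by (simp_all add: E(4) Qf 2 flip: proj_act_mult)
    then have "A ** A = mat 1"
      using fix3[OF AA Q(3,4) S(3) Q(2)] R(2) Q(1) by blast
    then show ?thesis using fix2_involution[OF A Q(3,4,2) E(4) Qf] by blast
  qed
qed

text \<open>By \<open>pair_fix\<close>, both \<open>g\<close> and \<open>h\<close> swap the points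
  of \<open>E\<close>. Their quotient therefore fixes these points and stabilises \<open>D\<close>,
  so it is trivial.\<close>

lemma pair_rigid:
  assumes gh: "g \<in> carrier Sz" "h \<in> carrier Sz" "g \<noteq> mat 1" "h \<noteq> mat 1"
    and E: "E \<in> pairs" "pair_act E g = E" "pair_act E h = E"
    and F: "F \<in> pairs" "F \<noteq> E" "pair_act F g = F"
    and F': "F' \<in> pairs" "F' \<noteq> E" "pair_act F' h = F'"
    and D: "D \<in> pairs" "D \<noteq> E" "pair_act D g = pair_act D h"
  shows "g = h"
proof -
  have "E \<noteq> {}" using E(1) by (auto simp: pairs_def)
  then obtain P where P: "P \<in> E" by blast
  obtain Q where Q: "E = {P, Q}" "P \<noteq> Q" "P \<in> ovoid" "Q \<in> ovoid" using E(1) P by (rule pairsE)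
  have "proj_act P g \<noteq> P" "proj_act P h \<noteq> P"
    using pair_fix[OF gh(1) E(1,2) P _ F(1,3,2)] pair_fix[OF gh(2) E(1,3) P _ F'(1,3,2)] gh(3,4)
    by blast+
  then have "proj_act P g = Q" "proj_act P h = Q"
    using E(2,3) Q(1) by (auto simp: pair_act_def)
  then have "proj_act P (g ** inv\<^bsub>Sz\<^esub> h) = P"
    using act_inv(1)[OF gh(2), of P] by (simp flip: proj_act_mult)
  moreover have "pair_act E (g ** inv\<^bsub>Sz\<^esub> h) = E" "pair_act D (g ** inv\<^bsub>Sz\<^esub> h) = D"
    using pair_act_inv[OF gh(2), of E] pair_act_inv[OF gh(2), of D] E D by (simp_all flip: pair_act_mult)
  moreover have "g ** inv\<^bsub>Sz\<^esub> h \<in> carrier Sz"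
    using gh Sz.m_closed[of g "inv\<^bsub>Sz\<^esub> h"] by (simp add: mult_Sz)
  ultimately have "g \<otimes>\<^bsub>Sz\<^esub> inv\<^bsub>Sz\<^esub> h = \<one>\<^bsub>Sz\<^esub>"
    using pair_fix[OF _ E(1) _ P _ D(1) _ D(2)] unfolding mult_Sz one_Sz by blast
  then show ?thesis
    using Sz.inv_equality[of g "inv\<^bsub>Sz\<^esub> h"] gh by simp
qed

section \<open>Relational complexity of the action on pairs\<close>

text \<open>The equation \<open>c * \<theta> c = t\<close> is solved by
  \<open>c = \<theta> t / t\<close>, since
  \<open>\<theta> c = t\<^sup>2 / \<theta> t\<close>.\<close>

lemma torus_transitive:
  assumes "u \<noteq> 0" "v \<noteq> 0"
  obtains c where "c \<noteq> 0" "c * \<theta> c * u = v"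
proof (rule that[of "\<theta> (v / u) / (v / u)"])
  show "\<theta> (v / u) / (v / u) \<noteq> 0" using assms by (simp add: theta_simps)
  show "\<theta> (v / u) / (v / u) * \<theta> (\<theta> (v / u) / (v / u)) * u = v"
    using assms by (simp add: theta_simps theta_theta power2_eq_square)
qed

lemma relational_complexity_pair_stabilizer:
  assumes E0: "E0 \<in> pairs" and H: "H = {g \<in> carrier Sz. pair_act E0 g = E0}"
  shows "relational_complexity Sz (rcosets\<^bsub>Sz\<^esub> H) (\<lambda>C g. C #>\<^bsub>Sz\<^esub> g) = 3"
proof -
  have sub: "H \<subseteq> carrier Sz" by (auto simp: H)
  \<comment> \<open>Sends the coset of \<open>g\<close> to the image of \<open>E0\<close> under
    \<open>g\<close>. Any representative serves, because \<open>H\<close> stabilises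
    \<open>E0\<close>; the facts below make this an equivariant bijection onto
    \<open>pairs\<close>.\<close>
  define \<phi> where "\<phi> C = pair_act E0 (SOME g. g \<in> C)" for C
  have \<phi>: "\<phi> (H #>\<^bsub>Sz\<^esub> g) = pair_act E0 g" if g: "g \<in> carrier Sz" for g
  proof -
    have "\<one>\<^bsub>Sz\<^esub> \<in> H" by (simp add: H pair_act_one[folded one_Sz])
    then have "\<exists>k. k \<in> H #>\<^bsub>Sz\<^esub> g" by (auto simp: r_coset_def)
    then have "(SOME k. k \<in> H #>\<^bsub>Sz\<^esub> g) \<in> H #>\<^bsub>Sz\<^esub> g" by (rule someI_ex)
    then obtain h where "h \<in> H" "(SOME k. k \<in> H #>\<^bsub>Sz\<^esub> g) = h ** g"
      by (auto simp: r_coset_def mult_Sz)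
    then show ?thesis by (simp add: \<phi>_def H flip: pair_act_mult)
  qed
  have \<phi>_act: "\<phi> (C #>\<^bsub>Sz\<^esub> g) = pair_act (\<phi> C) g"
    if "C \<in> rcosets\<^bsub>Sz\<^esub> H" "g \<in> carrier Sz" for C g
  proof -
    obtain a where a: "a \<in> carrier Sz" "C = H #>\<^bsub>Sz\<^esub> a" using \<open>C \<in> _\<close> by (auto simp: RCOSETS_def)
    then show ?thesis
      using \<open>g \<in> _\<close> sub by (simp add: Sz.coset_mult_assoc \<phi>) (simp add: mult_Sz pair_act_mult)
  qed
  have \<phi>_pairs: "\<phi> C \<in> pairs" if "C \<in> rcosets\<^bsub>Sz\<^esub> H" for C
    using that E0 by (auto simp: RCOSETS_def \<phi> pair_act_closed)
  have \<phi>_inj: "C = D" if C: "C \<in> rcosets\<^bsub>Sz\<^esub> H" and D: "D \<in> rcosets\<^bsub>Sz\<^esub> H" and eq: "\<phi> C = \<phi> D" for C D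
  proof -
    obtain a b where ab: "a \<in> carrier Sz" "C = H #>\<^bsub>Sz\<^esub> a" "b \<in> carrier Sz" "D = H #>\<^bsub>Sz\<^esub> b"
      using C D by (auto simp: RCOSETS_def)
    then have "pair_act E0 a = pair_act E0 b" using eq by (simp add: \<phi>)
    then have "pair_act E0 (a \<otimes>\<^bsub>Sz\<^esub> inv\<^bsub>Sz\<^esub> b) = E0"
      using ab pair_act_inv[of b E0] by (simp add: mult_Sz flip: pair_act_mult)
    then have mem: "a \<otimes>\<^bsub>Sz\<^esub> inv\<^bsub>Sz\<^esub> b \<in> H" using ab by (simp add: H)
    have "subgroup H Sz"
    proof (rule Sz.subgroupI)
      show "H \<noteq> {}" using mem by blast
      show "inv\<^bsub>Sz\<^esub> k \<in> H" if "k \<in> H" for k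
        using that pair_act_inv[of k E0] by (simp add: H)
      show "k \<otimes>\<^bsub>Sz\<^esub> l \<in> H" if "k \<in> H" "l \<in> H" for k l
        using that Sz.m_closed[of k l] by (auto simp: H mult_Sz simp flip: pair_act_mult)
    qed (rule sub)
    then have "H #>\<^bsub>Sz\<^esub> (a \<otimes>\<^bsub>Sz\<^esub> inv\<^bsub>Sz\<^esub> b) = H"
      using Sz.coset_join2 ab mem by simp
    then have "(H #>\<^bsub>Sz\<^esub> (a \<otimes>\<^bsub>Sz\<^esub> inv\<^bsub>Sz\<^esub> b)) #>\<^bsub>Sz\<^esub> b = D" using ab by simp
    then show ?thesis
      using ab sub by (simp add: Sz.coset_mult_assoc Sz.m_assoc)
  qed
  have \<phi>_eq: "C #>\<^bsub>Sz\<^esub> g = D \<longleftrightarrow> pair_act (\<phi> C) g = \<phi> D"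
    if "C \<in> rcosets\<^bsub>Sz\<^esub> H" "D \<in> rcosets\<^bsub>Sz\<^esub> H" "g \<in> carrier Sz" for C D g
  proof -
    have "C #>\<^bsub>Sz\<^esub> g \<in> rcosets\<^bsub>Sz\<^esub> H"
      using that sub by (auto simp: RCOSETS_def Sz.coset_mult_assoc)
    then show ?thesis using \<phi>_inj[of "C #>\<^bsub>Sz\<^esub> g" D] \<phi>_act[of C g] that by auto
  qed
  interpret rigid_action Sz "rcosets\<^bsub>Sz\<^esub> H" "\<lambda>C g. C #>\<^bsub>Sz\<^esub> g"
  proof
    show "C #>\<^bsub>Sz\<^esub> g \<in> rcosets\<^bsub>Sz\<^esub> H" if "C \<in> rcosets\<^bsub>Sz\<^esub> H" "g \<in> carrier Sz" for C g
      using that sub by (auto simp: RCOSETS_def Sz.coset_mult_assoc)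
    show "C #>\<^bsub>Sz\<^esub> \<one>\<^bsub>Sz\<^esub> = C" if "C \<in> rcosets\<^bsub>Sz\<^esub> H" for C
      using that sub by (auto simp: RCOSETS_def Sz.coset_mult_assoc)
    show "C #>\<^bsub>Sz\<^esub> g #>\<^bsub>Sz\<^esub> h = C #>\<^bsub>Sz\<^esub> (g \<otimes>\<^bsub>Sz\<^esub> h)"
      if "C \<in> rcosets\<^bsub>Sz\<^esub> H" "g \<in> carrier Sz" "h \<in> carrier Sz" for C g h
      using that sub by (auto simp: RCOSETS_def Sz.coset_mult_assoc Sz.m_assoc)
  next
    fix x g h y y' z
    assume *: "x \<in> rcosets\<^bsub>Sz\<^esub> H" "g \<in> carrier Sz" "h \<in> carrier Sz" "g \<noteq> \<one>\<^bsub>Sz\<^esub>" "h \<noteq> \<one>\<^bsub>Sz\<^esub>"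
      "x #>\<^bsub>Sz\<^esub> g = x" "x #>\<^bsub>Sz\<^esub> h = x"
      "y \<in> rcosets\<^bsub>Sz\<^esub> H" "y \<noteq> x" "y #>\<^bsub>Sz\<^esub> g = y"
      "y' \<in> rcosets\<^bsub>Sz\<^esub> H" "y' \<noteq> x" "y' #>\<^bsub>Sz\<^esub> h = y'"
      "z \<in> rcosets\<^bsub>Sz\<^esub> H" "z \<noteq> x" "z #>\<^bsub>Sz\<^esub> g = z #>\<^bsub>Sz\<^esub> h"
    have z: "pair_act (\<phi> z) g = pair_act (\<phi> z) h"
      using *(16) \<phi>_act[OF *(14,2)] \<phi>_act[OF *(14,3)] by simp
    have neq: "\<phi> y \<noteq> \<phi> x" "\<phi> y' \<noteq> \<phi> x" "\<phi> z \<noteq> \<phi> x"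
      using \<phi>_inj[OF *(8,1)] \<phi>_inj[OF *(11,1)] \<phi>_inj[OF *(14,1)] *(9,12,15) by blast+
    have stab: "pair_act (\<phi> x) g = \<phi> x" "pair_act (\<phi> x) h = \<phi> x"
      "pair_act (\<phi> y) g = \<phi> y" "pair_act (\<phi> y') h = \<phi> y'"
      using \<phi>_eq[OF *(1,1,2)] \<phi>_eq[OF *(1,1,3)] \<phi>_eq[OF *(8,8,2)] \<phi>_eq[OF *(11,11,3)] *(6,7,10,13)
      by blast+
    show "g = h"
      by (rule pair_rigid[OF *(2,3,4,5)[unfolded one_Sz] \<phi>_pairs[OF *(1)] stab(1,2)
            \<phi>_pairs[OF *(8)] neq(1) stab(3) \<phi>_pairs[OF *(11)] neq(2) stab(4)
            \<phi>_pairs[OF *(14)] neq(3) z])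
  qed
  have surj: "\<exists>C \<in> rcosets\<^bsub>Sz\<^esub> H. \<phi> C = E" if E: "E \<in> pairs" for E
  proof -
    have "\<exists>g\<in>carrier Sz. pair_act {infinity, affine_point 0 0} g = D" if D: "D \<in> pairs" for D
    proof -
      have "D \<noteq> {}" using D by (auto simp: pairs_def)
      then obtain P where P: "P \<in> D" by blast
      obtain Q where Q: "D = {P, Q}" "P \<noteq> Q" "P \<in> ovoid" "Q \<in> ovoid" using D P by (rule pairsE)
      obtain g where "g \<in> carrier Sz" "proj_act infinity g = P" "proj_act (affine_point 0 0) g = Q"
        using two_transitive[OF Q(3,4,2)] .
      then show ?thesis by (intro bexI[of _ g]) (simp_all add: pair_act_def Q(1))
    qed
    then obtain g h where g: "g \<in> carrier Sz" "pair_act {infinity, affine_point 0 0} g = E0"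
      and h: "h \<in> carrier Sz" "pair_act {infinity, affine_point 0 0} h = E"
      using E E0 by blast
    have "pair_act E0 (inv\<^bsub>Sz\<^esub> g \<otimes>\<^bsub>Sz\<^esub> h) = E"
      using g h pair_act_inv[OF g(1), of "{infinity, affine_point 0 0}"]
      by (simp add: mult_Sz flip: pair_act_mult)
    then show ?thesis
      using g h by (intro bexI[of _ "H #>\<^bsub>Sz\<^esub> (inv\<^bsub>Sz\<^esub> g \<otimes>\<^bsub>Sz\<^esub> h)"]) (simp_all add: \<phi> Sz.rcosetsI[OF sub])
  qed
  obtain w :: 'a where w: "w \<noteq> 0" "w \<noteq> 1" using exists_not_0_1 by blast
  have w1: "w + 1 \<noteq> 0" using w(2) char_2[of 1] by (metis add_right_cancel)
  have ww1: "w \<noteq> w + 1" by simp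
  define pt where "pt y = {infinity, affine_point 0 y}" for y
  have pt: "pt y \<in> pairs" for y by (auto simp: pt_def pairsI ovoid_simps point_simps)
  have pt_eq: "pt y = pt y' \<longleftrightarrow> y = y'" for y y'
    by (auto simp: pt_def doubleton_eq_iff point_simps)
  obtain a b c d where abcd: "a \<in> rcosets\<^bsub>Sz\<^esub> H" "\<phi> a = pt 0" "b \<in> rcosets\<^bsub>Sz\<^esub> H" "\<phi> b = pt 1"
    "c \<in> rcosets\<^bsub>Sz\<^esub> H" "\<phi> c = pt w" "d \<in> rcosets\<^bsub>Sz\<^esub> H" "\<phi> d = pt (w + 1)"
    using surj[OF pt] by metis
  obtain k where k: "k \<noteq> 0" "k * \<theta> k * w = w + 1" using torus_transitive[OF w(1) w1] .
  obtain l where l: "l \<noteq> 0" "l * \<theta> l * (w + 1) = w" using torus_transitive[OF w1 w(1)] .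
  have M: "pair_act (pt y) (suzuki_M e c) = pt (c * \<theta> c * y)" if "c \<noteq> 0" for c y
    using that by (simp add: pt_def pair_act_def act_M)
  have S: "pair_act (pt y) (suzuki_S e 0 1) = pt (y + 1)" for y
    by (simp add: pt_def pair_act_def act_S theta_simps)
  show ?thesis
  proof (rule relational_complexity_eq_3[OF abcd(1,3,5,7)])
    show "suzuki_M e k \<in> carrier Sz" using k(1) by (rule generators_in_Sz)
    then show "a #>\<^bsub>Sz\<^esub> suzuki_M e k = a" "c #>\<^bsub>Sz\<^esub> suzuki_M e k = d"
      using abcd k by (simp_all add: \<phi>_eq M)
    \<comment> \<open>A torus element conjugated by the translation that exchanges
      \<open>(0, 0)\<close> and \<open>(0, 1)\<close>: it fixes \<open>(0, 1)\<close> and sends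
      \<open>(0, w)\<close> to \<open>(0, w + 1)\<close>.\<close>
    let ?h = "suzuki_S e 0 1 \<otimes>\<^bsub>Sz\<^esub> suzuki_M e l \<otimes>\<^bsub>Sz\<^esub> suzuki_S e 0 1"
    show h: "?h \<in> carrier Sz" using l(1) by (intro Sz.m_closed generators_in_Sz)
    have ph: "pair_act (pt y) ?h = pt (l * \<theta> l * (y + 1) + 1)" for y
      using l(1) by (simp add: mult_Sz M S flip: pair_act_mult)
    show "b #>\<^bsub>Sz\<^esub> ?h = b" "c #>\<^bsub>Sz\<^esub> ?h = d"
      using abcd l h by (simp_all add: \<phi>_eq ph char_2)
    show "\<not> (\<exists>k\<in>carrier Sz. a #>\<^bsub>Sz\<^esub> k = a \<and> b #>\<^bsub>Sz\<^esub> k = b \<and> c #>\<^bsub>Sz\<^esub> k = d)"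
    proof
      assume "\<exists>k\<in>carrier Sz. a #>\<^bsub>Sz\<^esub> k = a \<and> b #>\<^bsub>Sz\<^esub> k = b \<and> c #>\<^bsub>Sz\<^esub> k = d"
      then obtain k where k: "k \<in> carrier Sz" "pair_act (pt 0) k = pt 0" "pair_act (pt 1) k = pt 1"
        "pair_act (pt w) k = pt (w + 1)"
        using abcd by (metis \<phi>_eq)
      \<comment> \<open>The only common point of the two stabilised pairs is
        \<open>infinity\<close>; it is therefore fixed, and \<open>pair_fix\<close> makes
        \<open>k\<close> trivial.\<close>
      have "proj_act infinity k \<in> pt 0 \<inter> pt 1"
        using k(2,3) unfolding pair_act_def by (auto simp: pt_def)
      then have "proj_act infinity k = infinity" by (auto simp: pt_def point_simps)
      then have "k = mat 1"
        using pair_fix[of k "pt 0" infinity "pt 1"] k pt pt_eq by (auto simp: pt_def)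
      then show False using k(4) ww1 by (simp add: pair_act_one pt_eq)
    qed
  qed
qed

section \<open>Maximal dihedral subgroups as pair stabilisers\<close>

text \<open>
  A rotation \<open>c \<in> H\<close> of prime order \<open>p\<close> fixes at most two points, and \<open>q\<^sup>2 + 1 \<equiv> 2\<close> modulo \<open>p\<close> by
  orbit counting, hence exactly two. As \<open>H\<close> normalises the group generated by \<open>c\<close>, it preserves this
  pair.
\<close>

lemma dihedral_eq_pair_stabilizer:
  assumes max: "maximal_subgroup H Sz" and iso: "Sz\<lparr>carrier := H\<rparr> \<cong> dihedral_group (2 ^ e - 1)"
  shows "\<exists>E\<in>pairs. H = {g \<in> carrier Sz. pair_act E g = E}"
proof -
  define n :: nat where "n = 2 ^ e - 1"
  have "(2::nat) ^ 2 \<le> 2 ^ e" using e_gt_1 by (intro power_increasing) auto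
  then have n: "n \<ge> 3" "2 ^ e = n + 1" by (simp_all add: n_def)
  have "odd n" using e_gt_1 by (simp add: n_def)
  obtain p where p: "prime p" "p dvd n" using n(1) prime_factor_nat[of n] by auto
  \<comment> \<open>An odd prime is essential: the residue 2 modulo \<open>p\<close> must exclude 0
    and 1 fixed points.\<close>
  have p3: "p \<ge> 3"
    using p \<open>odd n\<close> prime_ge_2_nat[OF p(1)] by (cases "p = 2") auto
  define k where "k = n div p"
  have nk: "n = k * p" using p(2) by (simp add: k_def)
  have k: "0 < k" "k < n" using n(1) nk p3 by (auto intro!: Nat.gr0I)
  have subH: "subgroup H Sz" using max by (simp add: maximal_subgroup_def)
  have HG: "H \<subseteq> carrier Sz" using subH by (rule subgroup.subset)
  interpret SzH: group "Sz\<lparr>carrier := H\<rparr>" using subH by (rule Sz.subgroup_imp_group)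
  have "dihedral_group n \<cong> Sz\<lparr>carrier := H\<rparr>"
    using SzH.iso_sym iso by (simp add: n_def)
  then obtain f where f: "f \<in> iso (dihedral_group n) (Sz\<lparr>carrier := H\<rparr>)"
    unfolding is_iso_def by blast
  have f_bij: "bij_betw f (carrier (dihedral_group n)) H" using f by (simp add: iso_def)
  have f_mult: "f (x \<otimes>\<^bsub>dihedral_group n\<^esub> y) = f x ** f y"
    if "x \<in> carrier (dihedral_group n)" "y \<in> carrier (dihedral_group n)" for x y
    using f that by (simp add: iso_def hom_def mult_Sz)
  have "group (dihedral_group n)" using n(1) by (intro group_dihedral_group) simp
  then have "f \<one>\<^bsub>dihedral_group n\<^esub> = \<one>\<^bsub>Sz\<lparr>carrier := H\<rparr>\<^esub>"
    using f SzH.is_group by (intro hom_one) (auto simp: iso_def)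
  then have f_one: "f (0, False) = mat 1" by (simp add: dihedral_group_def one_Sz)
  have car: "(int i mod int n, s) \<in> carrier (dihedral_group n)" for i s
    using n(1) by (simp add: dihedral_group_def)
  define c where "c = f (int k, False)"
  have kcar: "(int k, False) \<in> carrier (dihedral_group n)" using k by (simp add: dihedral_group_def)
  have cH: "c \<in> H" using f_bij kcar by (auto simp: c_def bij_betw_def)
  have cG: "c \<in> carrier Sz" using cH HG by blast
  have c1: "c \<noteq> mat 1"
  proof
    assume "c = mat 1"
    then have "f (int k, False) = f (0, False)" by (simp add: c_def f_one)
    then show False
      using f_bij kcar car[of 0 False] k by (auto simp: bij_betw_def dest!: inj_onD)
  qed
  \<comment> \<open>Powers of \<open>c\<close> act as iterates; at \<open>i = p\<close> the rotation
    index \<open>p * k = n\<close> is 0 modulo \<open>n\<close>.\<close>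
  have pow: "proj_act P (f (int (i * k) mod int n, False)) = ((\<lambda>P. proj_act P c) ^^ i) P" for i P
  proof (induction i)
    case 0
    then show ?case by (simp add: f_one proj_act_one)
  next
    case (Suc i)
    have "(int (Suc i * k) mod int n, False) =
        (int (i * k) mod int n, False) \<otimes>\<^bsub>dihedral_group n\<^esub> (int k, False)"
      by (simp add: dihedral_group_def mod_simps algebra_simps)
    then have "f (int (Suc i * k) mod int n, False) = f (int (i * k) mod int n, False) ** c"
      by (simp only: f_mult[OF car kcar] c_def)
    then show ?case using Suc by (simp flip: proj_act_mult)
  qed
  define F where "F = {P \<in> ovoid. proj_act P c = P}"
  have "finite F" using finite_ovoid by (simp add: F_def)
  have cong: "[card F = card ovoid] (mod p)"
    unfolding F_def
  proof (rule card_fixed_points_cong[OF finite_ovoid p(1)])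
    show "(\<lambda>P. proj_act P c) ` ovoid \<subseteq> ovoid" using act_ovoid[OF cG] by auto
    show "((\<lambda>P. proj_act P c) ^^ p) P = P" for P
      using pow[of P p] nk by (simp add: f_one proj_act_one mult.commute)
  qed
  have card_eq: "card ovoid = p * (k * (n + 2)) + 2"
    unfolding card_ovoid n(2) by (simp add: power2_eq_square algebra_simps nk)
  then have cong2: "card F mod p = 2"
    using cong p3 unfolding cong_def card_eq mod_mult_self4 by simp
  have "card F \<le> 2"
  proof (rule ccontr)
    assume "\<not> card F \<le> 2"
    then obtain T where "T \<subseteq> F" "card T = 3"
      using obtain_subset_with_card_n[of 3 F] by auto
    then obtain P Q R where "P \<in> F" "Q \<in> F" "R \<in> F" "P \<noteq> Q" "R \<noteq> P" "R \<noteq> Q"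
      by (auto simp: card_3_iff)
    then show False using fix3[OF cG, of P Q R] c1 by (auto simp: F_def)
  qed
  then have "card F = 2" using cong2 p3 by (cases "card F = 2") auto
  then have F: "F \<in> pairs" by (auto simp: pairs_def F_def)
  \<comment> \<open>Rotations commute with \<open>c\<close>, and reflections invert it; the second
    case is written without inverses.\<close>
  have normal: "h ** c = c ** h \<or> c ** (h ** c) = h" if "h \<in> H" for h
  proof -
    obtain x where x: "x \<in> carrier (dihedral_group n)" "h = f x"
      using f_bij \<open>h \<in> H\<close> unfolding bij_betw_def by blast
    obtain i s where xis: "x = (i, s)" by (cases x)
    have i: "0 \<le> i" "i < int n" using x xis by (auto simp: dihedral_group_def)
    show ?thesis
    proof (cases s)
      case True
      have "(int k, False) \<otimes>\<^bsub>dihedral_group n\<^esub> (x \<otimes>\<^bsub>dihedral_group n\<^esub> (int k, False)) = x"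
        using i True by (simp add: xis dihedral_group_def mod_simps)
      moreover have "x \<otimes>\<^bsub>dihedral_group n\<^esub> (int k, False) \<in> carrier (dihedral_group n)"
        using x kcar \<open>group (dihedral_group n)\<close> by (intro monoid.m_closed group.is_monoid)
      ultimately show ?thesis using f_mult x kcar by (simp add: c_def) metis
    next
      case False
      then have "x \<otimes>\<^bsub>dihedral_group n\<^esub> (int k, False) = (int k, False) \<otimes>\<^bsub>dihedral_group n\<^esub> x"
        by (simp add: xis dihedral_group_def add.commute)
      then show ?thesis using f_mult x kcar by (simp add: c_def) metis
    qed
  qed
  have HF: "pair_act F h = F" if h: "h \<in> H" for h
  proof -
    have hG: "h \<in> carrier Sz" using h HG by blast
    have "pair_act F h \<subseteq> F"
    proof -
      have "proj_act P h \<in> F" if P: "P \<in> F" for P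
      proof -
        have Pc: "proj_act P c = P" using P by (simp add: F_def)
        have "proj_act (proj_act P h) c = proj_act P h"
          using normal[OF h]
        proof
          assume "h ** c = c ** h"
          then have "proj_act (proj_act P h) c = proj_act (proj_act P c) h"
            by (simp only: proj_act_mult)
          then show ?thesis by (simp only: Pc)
        next
          assume "c ** (h ** c) = h"
          then have "proj_act (proj_act P c) (h ** c) = proj_act P h"
            by (simp only: proj_act_mult)
          then show ?thesis by (simp only: Pc proj_act_mult)
        qed
        then show ?thesis using P act_ovoid[OF hG] by (simp add: F_def)
      qed
      then show ?thesis by (auto simp: pair_act_def)
    qed
    moreover have "card (pair_act F h) = card F"
      using pair_act_closed[OF hG F] F by (simp add: pairs_def)
    ultimately show ?thesis using \<open>finite F\<close> card_subset_eq by blast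
  qed
  \<comment> \<open>The stabiliser of \<open>F\<close> is a proper subgroup containing
    \<open>H\<close>, so maximality gives equality.\<close>
  define K where "K = {g \<in> carrier Sz. pair_act F g = F}"
  have "subgroup K Sz"
  proof (rule Sz.subgroupI)
    show "K \<subseteq> carrier Sz" by (auto simp: K_def)
    show "K \<noteq> {}" using cH cG HF by (auto simp: K_def)
    show "inv\<^bsub>Sz\<^esub> g \<in> K" if "g \<in> K" for g
      using that pair_act_inv[of g F] by (simp add: K_def)
    show "g \<otimes>\<^bsub>Sz\<^esub> h \<in> K" if "g \<in> K" "h \<in> K" for g h
      using that Sz.m_closed[of g h] by (auto simp: K_def mult_Sz simp flip: pair_act_mult)
  qed
  moreover have "H \<subseteq> K" using HF HG by (auto simp: K_def)
  moreover have "K \<noteq> carrier Sz"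
  proof
    assume all: "K = carrier Sz"
    have "F \<noteq> {}" using \<open>card F = 2\<close> by auto
    then obtain P where P: "P \<in> F" by blast
    obtain Q where Q: "F = {P, Q}" "P \<noteq> Q" "P \<in> ovoid" "Q \<in> ovoid" using F P by (rule pairsE)
    have "card ovoid > card F" using \<open>card ovoid = _\<close> \<open>card F = 2\<close> p3 k by simp
    then obtain R where R: "R \<in> ovoid" "R \<notin> F"
      using \<open>finite F\<close> by (meson card_mono not_less subsetI)
    obtain g where g: "g \<in> carrier Sz" "proj_act infinity g = P" "proj_act (affine_point 0 0) g = Q"
      using two_transitive[OF Q(3,4,2)] .
    obtain h where h: "h \<in> carrier Sz" "proj_act infinity h = P" "proj_act (affine_point 0 0) h = R"
      using two_transitive[OF Q(3) R(1)] R(2) P by metis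
    \<comment> \<open>This element moves the point \<open>Q\<close> of \<open>F\<close> to
      \<open>R\<close> outside \<open>F\<close>.\<close>
    have "inv\<^bsub>Sz\<^esub> g \<otimes>\<^bsub>Sz\<^esub> h \<in> K" using all g h by simp
    moreover have "proj_act Q (inv\<^bsub>Sz\<^esub> g \<otimes>\<^bsub>Sz\<^esub> h) = R"
      using act_inv(1)[OF g(1), of "affine_point 0 0"] g h by (simp add: mult_Sz flip: proj_act_mult)
    ultimately show False using Q(1) R(2) by (auto simp: K_def pair_act_def)
  qed
  ultimately have "H = K" using max unfolding maximal_subgroup_def by blast
  then show ?thesis using F by (auto simp: K_def)
qed

end

theorem theorem5p4p7:
  fixes e q :: nat
    and H :: "('a::{field,finite}^4^4) set"
  assumes "odd e" and "e > 1" and "q = 2 ^ e" and "CARD('a) = q"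
    and "maximal_subgroup H (suzuki_group e)"
    and "(suzuki_group e)\<lparr>carrier := H\<rparr> \<cong> dihedral_group (q - 1)"
  shows "relational_complexity (suzuki_group e) (rcosets\<^bsub>suzuki_group e\<^esub> H)
           (\<lambda>C g. C #>\<^bsub>suzuki_group e\<^esub> g) = 3"
proof -
  interpret suzuki_field e "TYPE('a)"
    using assms by unfold_locales simp_all
  obtain E where "E \<in> pairs" "H = {g \<in> carrier (suzuki_group e). pair_act E g = E}"
    using dihedral_eq_pair_stabilizer assms by blast
  then show ?thesis by (rule relational_complexity_pair_stabilizer)
qed

end
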